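(* For $k=1,\dots,r$ let $(\mathcal R_k,\mathcal D_k,\mathcal V_k,\mathcal E_k)$ be a subregular risk quadrangle on $\mathcal L^p$ with statistic $\mathcal S_k$, and consider any weights $\lambda_k>0$ with $\lambda_1+\cdots+\lambda_r=1$. Then the quartet $(\mathcal R,\mathcal D,\mathcal V,\mathcal E)$ with statistic $\mathcal S$ given by $$\mathcal S(X)=\lambda_1\mathcal S_1(X)+\cdots+\lambda_r\mathcal S_r(X),$$ $$\mathcal R(X)=\lambda_1\mathcal R_1(X)+\cdots+\lambda_r\mathcal R_r(X),$$ $$\mathcal D(X)=\lambda_1\mathcal D_1(X)+\cdots+\lambda_r\mathcal D_r(X),$$ $$\mathcal V(X)=\min_{C_1,\dots,C_r}\Big\{\sum_{k=1}^r\lambda_k\mathcal V_k(X-C_k)\ \Big|\ \sum_{k=1}^r\lambda_kC_k=0\Big\},$$ $$\mathcal E(X)=\min_{C_1,\dots,C_r}\Big\{\sum_{k=1}^r\lambda_k\mathcal E_k(X-C_k)\ \Big|\ \sum_{k=1}^r\lambda_kC_k=0\Big\}$$ is a subregular risk quadrangle. Moreover, $(\mathcal R,\mathcal D,\mathcal V,\mathcal E)$ is monotone if every $(\mathcal R_k,\mathcal D_k,\mathcal V_k,\mathcal E_k)$ is monotone, and $(\mathcal R,\mathcal D,\mathcal V,\mathcal E)$ is positively homogeneous if every $(\mathcal R_k,\mathcal D_k,\mathcal V_k,\mathcal E_k)$ is positively homogeneous.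
   Context: Let $(\Omega,\mathcal M,\mathbb P)$ be a probability space. For $p\in[1,\infty]$, $\mathcal L^p=\mathcal L^p(\Omega,\mathcal M,\mathbb P)$ is the normed space of random variables (identified when equal almost surely) with $\|X\|_p<\infty$. Constants $C\in\mathbb R$ are identified with constant random variables. A functional $\mathcal F:\mathcal L^p\to(-\infty,\infty]$ is closed if $\{X:\mathcal F(X)\le C\}$ is closed in $\mathcal L^p$ for every constant $C$. It is monotone if $\mathcal F(X)\le\mathcal F(Y)$ whenever $X\le Y$ almost surely, and positively homogeneous if $\mathcal F(\lambda X)=\lambda\mathcal F(X)$ for all $\lambda>0$. A subregular measure of risk is a closed convex $\mathcal R:\mathcal L^p\to(-\infty,\infty]$ such that $\mathcal R(C)=C$ for constants $C$, $\mathcal R(X)\ge\mathbb E[X]$ for all $X$, and for every non-constant $X$ there is $\lambda>0$ with $\mathcal R(\lambda X)>\mathbb E[\lambda X]$. A subregular measure of deviation is a closed convex $\mathcal D:\mathcal L^p\to[0,\infty]$ such that $\mathcal D(C)=0$ for constants $C$, and for every non-constant $X$ there is $\lambda>0$ with $\mathcal D(\lambda X)>0$. A subregular measure of regret is a closed convex $\mathcal V:\mathcal L^p\to(-\infty,\infty]$ such that $\mathcal V(0)=0$, $\mathcal V(X)\ge\mathbb E[X]$ for all $X$, and for every non-zero $X$ there is $\lambda>0$ with $\mathcal V(\lambda X)>\mathbb E[\lambda X]$. A subregular measure of error is a closed convex $\mathcal E:\mathcal L^p\to[0,\infty]$ such that $\mathcal E(0)=0$, and for every non-zero $X$ there is $\lambda>0$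 with $\mathcal E(\lambda X)>0$. A subregular risk quadrangle with statistic $\mathcal S$ is a quartet $(\mathcal R,\mathcal D,\mathcal V,\mathcal E)$ of subregular measures of risk, deviation, regret and error satisfying, for all $X$: (Q1) $\mathcal D(X)=\min_C\mathcal E(X-C)$; (Q2) $\mathcal R(X)=\min_C\{C+\mathcal V(X-C)\}$; (Q3) $\mathcal R(X)=\mathcal D(X)+\mathbb E[X]$ and $\mathcal V(X)=\mathcal E(X)+\mathbb E[X]$; (Q4) $\mathcal S(X)=\operatorname{argmin}_C\mathcal E(X-C)=\operatorname{argmin}_C\{C+\mathcal V(X-C)\}$, a set of real numbers. Sums and positive multiples of the sets $\mathcal S_k(X)$ are in the Minkowski sense. A quadrangle is called monotone if $\mathcal R$ and $\mathcal V$ are monotone, and positively homogeneous if $\mathcal R,\mathcal D,\mathcal V,\mathcal E$ are positively homogeneous. *)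

theory Defs
  imports "HOL-Probability.Probability" "HOL-Library.Set_Algebras"
begin

section \<open>The space of random variables\<close>

text \<open>Random variables are kept as functions; the identification of almost surely equal ones
  appears as the invariance condition in \<open>Lp_functional\<close> and in the notions of constant and
  non-zero random variables below. The exponent ranges over \<^typ>\<open>ennreal\<close>, so that the case
  \<open>p = \<infinity>\<close> is included.\<close>

definition Lp_norm :: "'a measure \<Rightarrow> ennreal \<Rightarrow> ('a \<Rightarrow> real) \<Rightarrow> ennreal" where
  "Lp_norm M p X =
     (if p = \<infinity> then esssup M (\<lambda>\<omega>. ennreal \<bar>X \<omega>\<bar>)
      else let I = (\<integral>\<^sup>+ \<omega>. ennreal (\<bar>X \<omega>\<bar> powr enn2real p) \<partial>M)
           in if I = \<infinity> then \<infinity> else ennreal (enn2real I powr (1 / enn2real p)))"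

definition Lp :: "'a measure \<Rightarrow> ennreal \<Rightarrow> ('a \<Rightarrow> real) set" where
  "Lp M p = {X \<in> borel_measurable M. Lp_norm M p X < \<infinity>}"

definition Lp_topology :: "'a measure \<Rightarrow> ennreal \<Rightarrow> ('a \<Rightarrow> real) topology" where
  "Lp_topology M p = topology (\<lambda>U. U \<subseteq> Lp M p \<and>
     (\<forall>X\<in>U. \<exists>\<epsilon>>0. \<forall>Y\<in>Lp M p. Lp_norm M p (\<lambda>\<omega>. Y \<omega> - X \<omega>) < ennreal \<epsilon> \<longrightarrow> Y \<in> U))"

lemma openin_Lp_topology:
  "openin (Lp_topology M p) U \<longleftrightarrow> U \<subseteq> Lp M p \<and>
     (\<forall>X\<in>U. \<exists>\<epsilon>>0. \<forall>Y\<in>Lp M p. Lp_norm M p (\<lambda>\<omega>. Y \<omega> - X \<omega>) < ennreal \<epsilon> \<longrightarrow> Y \<in> U)"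
proof -
  let ?P = "\<lambda>U. U \<subseteq> Lp M p \<and>
     (\<forall>X\<in>U. \<exists>\<epsilon>>0. \<forall>Y\<in>Lp M p. Lp_norm M p (\<lambda>\<omega>. Y \<omega> - X \<omega>) < ennreal \<epsilon> \<longrightarrow> Y \<in> U)"
  have int: "?P (A \<inter> B)" if A: "?P A" and B: "?P B" for A B
  proof (intro conjI ballI)
    show "A \<inter> B \<subseteq> Lp M p" using A by blast
  next
    fix X assume X: "X \<in> A \<inter> B"
    obtain a where a: "a > 0"
      "\<And>Y. Y \<in> Lp M p \<Longrightarrow> Lp_norm M p (\<lambda>\<omega>. Y \<omega> - X \<omega>) < ennreal a \<Longrightarrow> Y \<in> A"
      using A X by blast
    obtain b where b: "b > 0"
      "\<And>Y. Y \<in> Lp M p \<Longrightarrow> Lp_norm M p (\<lambda>\<omega>. Y \<omega> - X \<omega>) < ennreal b \<Longrightarrow> Y \<in> B"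
      using B X by blast
    have le: "ennreal (min a b) \<le> ennreal a" "ennreal (min a b) \<le> ennreal b"
      by (simp_all add: ennreal_leI)
    show "\<exists>\<epsilon>>0. \<forall>Y\<in>Lp M p. Lp_norm M p (\<lambda>\<omega>. Y \<omega> - X \<omega>) < ennreal \<epsilon> \<longrightarrow> Y \<in> A \<inter> B"
    proof (intro exI[of _ "min a b"] conjI ballI impI)
      show "0 < min a b" using a(1) b(1) by simp
    next
      fix Y assume "Y \<in> Lp M p" "Lp_norm M p (\<lambda>\<omega>. Y \<omega> - X \<omega>) < ennreal (min a b)"
      then show "Y \<in> A \<inter> B"
        using a(2)[of Y] b(2)[of Y] le by (meson IntI order_less_le_trans)
    qed
  qed
  have un: "?P (\<Union>K)" if K: "\<forall>U\<in>K. ?P U" for K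
  proof (intro conjI ballI)
    show "\<Union>K \<subseteq> Lp M p" using K by blast
  next
    fix X assume "X \<in> \<Union>K"
    then obtain U where U: "U \<in> K" "X \<in> U" by blast
    then show "\<exists>\<epsilon>>0. \<forall>Y\<in>Lp M p. Lp_norm M p (\<lambda>\<omega>. Y \<omega> - X \<omega>) < ennreal \<epsilon> \<longrightarrow> Y \<in> \<Union>K"
      using K by (meson UnionI)
  qed
  have "istopology ?P"
    unfolding istopology_def using int un by blast
  then show ?thesis
    unfolding Lp_topology_def by (simp add: topology_inverse')
qed

lemma topspace_Lp_topology [simp]: "topspace (Lp_topology M p) = Lp M p"
proof -
  have "openin (Lp_topology M p) (Lp M p)"
    unfolding openin_Lp_topology by (auto intro: exI[of _ 1])
  moreover have "topspace (Lp_topology M p) \<subseteq> Lp M p"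
    using openin_topspace[of "Lp_topology M p"] unfolding openin_Lp_topology by blast
  ultimately show ?thesis
    using openin_subset by blast
qed

definition ae_constant :: "'a measure \<Rightarrow> ('a \<Rightarrow> real) \<Rightarrow> bool" where
  "ae_constant M X \<longleftrightarrow> (\<exists>C. AE \<omega> in M. X \<omega> = C)"

definition ae_zero :: "'a measure \<Rightarrow> ('a \<Rightarrow> real) \<Rightarrow> bool" where
  "ae_zero M X \<longleftrightarrow> (AE \<omega> in M. X \<omega> = 0)"


section \<open>Functionals\<close>

text \<open>A functional with values in \<open>(-\<infinity>, \<infinity>]\<close> on the space of almost sure classes. Its values
  outside \<^const>\<open>Lp\<close> are irrelevant.\<close>

definition Lp_functional :: "'a measure \<Rightarrow> ennreal \<Rightarrow> (('a \<Rightarrow> real) \<Rightarrow> ereal) \<Rightarrow> bool" where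
  "Lp_functional M p F \<longleftrightarrow>
     (\<forall>X\<in>Lp M p. F X \<noteq> -\<infinity>) \<and>
     (\<forall>X\<in>Lp M p. \<forall>Y\<in>Lp M p. (AE \<omega> in M. X \<omega> = Y \<omega>) \<longrightarrow> F X = F Y)"

definition closed_functional :: "'a measure \<Rightarrow> ennreal \<Rightarrow> (('a \<Rightarrow> real) \<Rightarrow> ereal) \<Rightarrow> bool" where
  "closed_functional M p F \<longleftrightarrow>
     (\<forall>C::real. closedin (Lp_topology M p) {X \<in> Lp M p. F X \<le> ereal C})"

definition convex_functional :: "'a measure \<Rightarrow> ennreal \<Rightarrow> (('a \<Rightarrow> real) \<Rightarrow> ereal) \<Rightarrow> bool" where
  "convex_functional M p F \<longleftrightarrow>
     (\<forall>X\<in>Lp M p. \<forall>Y\<in>Lp M p. \<forall>t::real. 0 < t \<and> t < 1 \<longrightarrow>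
        F (\<lambda>\<omega>. (1 - t) * X \<omega> + t * Y \<omega>) \<le> ereal (1 - t) * F X + ereal t * F Y)"

definition monotone_functional :: "'a measure \<Rightarrow> ennreal \<Rightarrow> (('a \<Rightarrow> real) \<Rightarrow> ereal) \<Rightarrow> bool" where
  "monotone_functional M p F \<longleftrightarrow>
     (\<forall>X\<in>Lp M p. \<forall>Y\<in>Lp M p. (AE \<omega> in M. X \<omega> \<le> Y \<omega>) \<longrightarrow> F X \<le> F Y)"

definition pos_homogeneous :: "'a measure \<Rightarrow> ennreal \<Rightarrow> (('a \<Rightarrow> real) \<Rightarrow> ereal) \<Rightarrow> bool" where
  "pos_homogeneous M p F \<longleftrightarrow>
     (\<forall>X\<in>Lp M p. \<forall>t::real. 0 < t \<longrightarrow> F (\<lambda>\<omega>. t * X \<omega>) = ereal t * F X)"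

definition subregular_risk :: "'a measure \<Rightarrow> ennreal \<Rightarrow> (('a \<Rightarrow> real) \<Rightarrow> ereal) \<Rightarrow> bool" where
  "subregular_risk M p R \<longleftrightarrow>
     Lp_functional M p R \<and> closed_functional M p R \<and> convex_functional M p R \<and>
     (\<forall>C. R (\<lambda>_. C) = ereal C) \<and>
     (\<forall>X\<in>Lp M p. R X \<ge> ereal (\<integral>\<omega>. X \<omega> \<partial>M)) \<and>
     (\<forall>X\<in>Lp M p. \<not> ae_constant M X \<longrightarrow>
        (\<exists>t>0. R (\<lambda>\<omega>. t * X \<omega>) > ereal (\<integral>\<omega>. t * X \<omega> \<partial>M)))"

definition subregular_deviation :: "'a measure \<Rightarrow> ennreal \<Rightarrow> (('a \<Rightarrow> real) \<Rightarrow> ereal) \<Rightarrow> bool" where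
  "subregular_deviation M p D \<longleftrightarrow>
     Lp_functional M p D \<and> closed_functional M p D \<and> convex_functional M p D \<and>
     (\<forall>X\<in>Lp M p. D X \<ge> 0) \<and>
     (\<forall>C. D (\<lambda>_. C) = 0) \<and>
     (\<forall>X\<in>Lp M p. \<not> ae_constant M X \<longrightarrow> (\<exists>t>0. D (\<lambda>\<omega>. t * X \<omega>) > 0))"

definition subregular_regret :: "'a measure \<Rightarrow> ennreal \<Rightarrow> (('a \<Rightarrow> real) \<Rightarrow> ereal) \<Rightarrow> bool" where
  "subregular_regret M p V \<longleftrightarrow>
     Lp_functional M p V \<and> closed_functional M p V \<and> convex_functional M p V \<and>
     V (\<lambda>_. 0) = 0 \<and>
     (\<forall>X\<in>Lp M p. V X \<ge> ereal (\<integral>\<omega>. X \<omega> \<partial>M)) \<and>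
     (\<forall>X\<in>Lp M p. \<not> ae_zero M X \<longrightarrow>
        (\<exists>t>0. V (\<lambda>\<omega>. t * X \<omega>) > ereal (\<integral>\<omega>. t * X \<omega> \<partial>M)))"

definition subregular_error :: "'a measure \<Rightarrow> ennreal \<Rightarrow> (('a \<Rightarrow> real) \<Rightarrow> ereal) \<Rightarrow> bool" where
  "subregular_error M p E \<longleftrightarrow>
     Lp_functional M p E \<and> closed_functional M p E \<and> convex_functional M p E \<and>
     (\<forall>X\<in>Lp M p. E X \<ge> 0) \<and>
     E (\<lambda>_. 0) = 0 \<and>
     (\<forall>X\<in>Lp M p. \<not> ae_zero M X \<longrightarrow> (\<exists>t>0. E (\<lambda>\<omega>. t * X \<omega>) > 0))"


section \<open>Quadrangles\<close>

text \<open>\<open>is_min_of m f P\<close>: the value \<open>m\<close> is the minimum of \<open>f\<close> subject to \<open>P\<close>, and it is attained.\<close>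

definition is_min_of :: "ereal \<Rightarrow> ('b \<Rightarrow> ereal) \<Rightarrow> ('b \<Rightarrow> bool) \<Rightarrow> bool" where
  "is_min_of m f P \<longleftrightarrow> (\<exists>x. is_arg_min f P x \<and> m = f x)"

text \<open>All minimizers; if \<open>f\<close> is identically \<open>\<infinity>\<close>, every point is one.\<close>

definition argmin_set :: "('b \<Rightarrow> ereal) \<Rightarrow> 'b set" where
  "argmin_set f = {x. is_arg_min f (\<lambda>_. True) x}"

definition subregular_quadrangle ::
  "'a measure \<Rightarrow> ennreal \<Rightarrow> (('a \<Rightarrow> real) \<Rightarrow> ereal) \<Rightarrow> (('a \<Rightarrow> real) \<Rightarrow> ereal) \<Rightarrow>
   (('a \<Rightarrow> real) \<Rightarrow> ereal) \<Rightarrow> (('a \<Rightarrow> real) \<Rightarrow> ereal) \<Rightarrow> (('a \<Rightarrow> real) \<Rightarrow> real set) \<Rightarrow> bool" where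
  "subregular_quadrangle M p R D V E S \<longleftrightarrow>
     subregular_risk M p R \<and> subregular_deviation M p D \<and>
     subregular_regret M p V \<and> subregular_error M p E \<and>
     (\<forall>X\<in>Lp M p.
        is_min_of (D X) (\<lambda>C::real. E (\<lambda>\<omega>. X \<omega> - C)) (\<lambda>_. True) \<and>
        is_min_of (R X) (\<lambda>C::real. ereal C + V (\<lambda>\<omega>. X \<omega> - C)) (\<lambda>_. True) \<and>
        R X = D X + ereal (\<integral>\<omega>. X \<omega> \<partial>M) \<and>
        V X = E X + ereal (\<integral>\<omega>. X \<omega> \<partial>M) \<and>
        S X = argmin_set (\<lambda>C::real. E (\<lambda>\<omega>. X \<omega> - C)) \<and>
        S X = argmin_set (\<lambda>C::real. ereal C + V (\<lambda>\<omega>. X \<omega> - C)))"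

definition monotone_quadrangle ::
  "'a measure \<Rightarrow> ennreal \<Rightarrow> (('a \<Rightarrow> real) \<Rightarrow> ereal) \<Rightarrow> (('a \<Rightarrow> real) \<Rightarrow> ereal) \<Rightarrow>
   (('a \<Rightarrow> real) \<Rightarrow> ereal) \<Rightarrow> (('a \<Rightarrow> real) \<Rightarrow> ereal) \<Rightarrow> bool" where
  "monotone_quadrangle M p R D V E \<longleftrightarrow> monotone_functional M p R \<and> monotone_functional M p V"

definition pos_homogeneous_quadrangle ::
  "'a measure \<Rightarrow> ennreal \<Rightarrow> (('a \<Rightarrow> real) \<Rightarrow> ereal) \<Rightarrow> (('a \<Rightarrow> real) \<Rightarrow> ereal) \<Rightarrow>
   (('a \<Rightarrow> real) \<Rightarrow> ereal) \<Rightarrow> (('a \<Rightarrow> real) \<Rightarrow> ereal) \<Rightarrow> bool" where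
  "pos_homogeneous_quadrangle M p R D V E \<longleftrightarrow>
     pos_homogeneous M p R \<and> pos_homogeneous M p D \<and>
     pos_homogeneous M p V \<and> pos_homogeneous M p E"


section \<open>Mixtures\<close>

definition mix_sum ::
  "nat \<Rightarrow> (nat \<Rightarrow> real) \<Rightarrow> (nat \<Rightarrow> ('a \<Rightarrow> real) \<Rightarrow> ereal) \<Rightarrow> ('a \<Rightarrow> real) \<Rightarrow> ereal" where
  "mix_sum r w F X = (\<Sum>k=1..r. ereal (w k) * F k X)"

text \<open>The sum below is the Minkowski sum of sets.\<close>

definition mix_statistic ::
  "nat \<Rightarrow> (nat \<Rightarrow> real) \<Rightarrow> (nat \<Rightarrow> ('a \<Rightarrow> real) \<Rightarrow> real set) \<Rightarrow> ('a \<Rightarrow> real) \<Rightarrow> real set" where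
  "mix_statistic r w S X = (\<Sum>k=1..r. (\<lambda>c. w k * c) ` S k X)"

text \<open>A tuple \<open>C\<^sub>1, \<dots>, C\<^sub>r\<close> is given by a function on the naturals of which only the values
  on \<open>{1..r}\<close> matter.\<close>

definition balanced :: "nat \<Rightarrow> (nat \<Rightarrow> real) \<Rightarrow> (nat \<Rightarrow> real) \<Rightarrow> bool" where
  "balanced r w c \<longleftrightarrow> (\<Sum>k=1..r. w k * c k) = 0"

definition shifted_sum ::
  "nat \<Rightarrow> (nat \<Rightarrow> real) \<Rightarrow> (nat \<Rightarrow> ('a \<Rightarrow> real) \<Rightarrow> ereal) \<Rightarrow> ('a \<Rightarrow> real) \<Rightarrow> (nat \<Rightarrow> real) \<Rightarrow> ereal" where
  "shifted_sum r w F X c = (\<Sum>k=1..r. ereal (w k) * F k (\<lambda>\<omega>. X \<omega> - c k))"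

definition mix_inf ::
  "nat \<Rightarrow> (nat \<Rightarrow> real) \<Rightarrow> (nat \<Rightarrow> ('a \<Rightarrow> real) \<Rightarrow> ereal) \<Rightarrow> ('a \<Rightarrow> real) \<Rightarrow> ereal" where
  "mix_inf r w F X = (INF c\<in>{c. balanced r w c}. shifted_sum r w F X c)"

end

theory Submission
  imports Defs
begin

text \<open>
  An error \<open>E\<^sub>k\<close> is coercive in constant shifts, uniformly over bounded sets of
  random variables: if \<open>E\<^sub>k (X\<^sub>n - c\<^sub>n) \<le> a\<close> with \<open>\<bar>c\<^sub>n\<bar> \<rightarrow> \<infinity>\<close>, then convexity and
  \<open>E\<^sub>k 0 = 0\<close> make the errors of \<open>(t / \<bar>c\<^sub>n\<bar>) (X\<^sub>n - c\<^sub>n)\<close> tend to \<open>0\<close>, so closedness forces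
  \<open>E\<^sub>k\<close> to vanish at \<open>-t\<close> for all \<open>t > 0\<close>, or at \<open>t\<close> for all \<open>t > 0\<close>, contrary to
  subregularity. Shifts of bounded total error therefore have convergent subsequences, which yields attainment of the minimum defining \<open>\<E>\<close> and
  closedness of \<open>\<E>\<close>. Substituting \<open>C + C\<^sub>k\<close> for the shifts decouples \<open>min\<^sub>C \<E> (X - C)\<close> into the
  separate minima \<open>D\<^sub>k X\<close>. Risk and regret follow by adding the expectation.
\<close>

section \<open>Convergence in \<open>Lp\<close> and closed functionals\<close>

text \<open>The sum is at most twice the larger absolute value, whose power is one of the two
  summands on the right.\<close>

lemma abs_add_powr_le:
  fixes a b q :: real
  assumes "0 \<le> q"
  shows "\<bar>a + b\<bar> powr q \<le> 2 powr q * (\<bar>a\<bar> powr q + \<bar>b\<bar> powr q)"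
proof -
  have "\<bar>a + b\<bar> powr q \<le> (2 * max \<bar>a\<bar> \<bar>b\<bar>) powr q"
    by (rule powr_mono2) (use assms in auto)
  also have "\<dots> = 2 powr q * max \<bar>a\<bar> \<bar>b\<bar> powr q"
    by (simp add: powr_mult)
  also have "\<dots> \<le> 2 powr q * (\<bar>a\<bar> powr q + \<bar>b\<bar> powr q)"
    by (rule mult_left_mono) (auto simp: max_def)
  finally show ?thesis .
qed

locale prob_Lp = prob_space M for M :: "'a measure" +
  fixes p :: ennreal
  assumes one_le_p: "1 \<le> p"
begin

lemma one_le_exponent: "p \<noteq> \<infinity> \<Longrightarrow> 1 \<le> enn2real p"
  using one_le_p enn2real_mono[of 1 p] by (simp add: top.not_eq_extremum)

text \<open>Powers are monotone on nonnegative reals, so the root in the norm can be moved to the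
  bound. Later estimates then work with a plain integral or an almost sure bound.\<close>

lemma Lp_norm_le_iff:
  assumes [measurable]: "X \<in> borel_measurable M" and a: "0 \<le> a"
  shows "Lp_norm M p X \<le> ennreal a \<longleftrightarrow>
    (if p = \<infinity> then AE \<omega> in M. \<bar>X \<omega>\<bar> \<le> a
     else (\<integral>\<^sup>+ \<omega>. ennreal (\<bar>X \<omega>\<bar> powr enn2real p) \<partial>M) \<le> ennreal (a powr enn2real p))"
proof (cases "p = \<infinity>")
  case True
  have "esssup M (\<lambda>\<omega>. ennreal \<bar>X \<omega>\<bar>) \<le> ennreal a \<longleftrightarrow> (AE \<omega> in M. ennreal \<bar>X \<omega>\<bar> \<le> ennreal a)"
  proof
    assume le: "esssup M (\<lambda>\<omega>. ennreal \<bar>X \<omega>\<bar>) \<le> ennreal a"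
    have "AE \<omega> in M. ennreal \<bar>X \<omega>\<bar> \<le> esssup M (\<lambda>\<omega>. ennreal \<bar>X \<omega>\<bar>)"
      by (rule esssup_AE)
    then show "AE \<omega> in M. ennreal \<bar>X \<omega>\<bar> \<le> ennreal a"
      by eventually_elim (use le in auto)
  qed (rule esssup_I, auto)
  with True a show ?thesis
    by (simp add: Lp_norm_def)
next
  case False
  let ?q = "enn2real p"
  let ?I = "\<integral>\<^sup>+ \<omega>. ennreal (\<bar>X \<omega>\<bar> powr ?q) \<partial>M"
  have q: "1 \<le> ?q" using one_le_exponent[OF False] .
  show ?thesis
  proof (cases "?I = \<infinity>")
    case True
    with False show ?thesis
      by (simp add: Lp_norm_def Let_def top_unique)
  next
    case fin: False
    then obtain i where i: "0 \<le> i" "?I = ennreal i"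
      by (cases ?I) auto
    have "i powr (1 / ?q) \<le> a \<longleftrightarrow> i \<le> a powr ?q"
    proof
      assume "i powr (1 / ?q) \<le> a"
      then have "(i powr (1 / ?q)) powr ?q \<le> a powr ?q"
        by (rule powr_mono2[rotated 2]) (use q in auto)
      then show "i \<le> a powr ?q" using q i by (simp add: powr_powr)
    next
      assume "i \<le> a powr ?q"
      then have "i powr (1 / ?q) \<le> (a powr ?q) powr (1 / ?q)"
        by (rule powr_mono2[rotated 2]) (use q i in auto)
      then show "i powr (1 / ?q) \<le> a" using q a by (simp add: powr_powr)
    qed
    with False i a show ?thesis
      by (simp add: Lp_norm_def Let_def ennreal_le_iff)
  qed
qed

lemma Lp_measurable: "X \<in> Lp M p \<Longrightarrow> X \<in> borel_measurable M"
  by (simp add: Lp_def)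

lemma Lp_normE:
  assumes "X \<in> Lp M p"
  obtains a where "0 < a" "Lp_norm M p X \<le> ennreal a"
proof -
  from assms have "Lp_norm M p X < \<infinity>" by (simp add: Lp_def)
  then obtain b where b: "0 \<le> b" "Lp_norm M p X = ennreal b"
    by (cases "Lp_norm M p X") auto
  \<comment> \<open>Adding 1 makes the bound positive even for norm 0, as
    \<open>Lp_expectation_bound\<close> requires.\<close>
  show ?thesis
    by (rule that[of "b + 1"]) (use b in \<open>auto intro: ennreal_leI\<close>)
qed

lemma LpI: "X \<in> borel_measurable M \<Longrightarrow> Lp_norm M p X \<le> ennreal a \<Longrightarrow> X \<in> Lp M p"
  by (auto simp: Lp_def intro: le_less_trans)

lemma Lp_norm_const_le: "Lp_norm M p (\<lambda>_. c) \<le> ennreal \<bar>c\<bar>"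
  by (subst Lp_norm_le_iff) (auto simp: emeasure_space_1)

lemma Lp_norm_scale_le:
  assumes X [measurable]: "X \<in> borel_measurable M" and a: "0 \<le> a" "Lp_norm M p X \<le> ennreal a"
  shows "Lp_norm M p (\<lambda>\<omega>. t * X \<omega>) \<le> ennreal (\<bar>t\<bar> * a)"
proof (cases "p = \<infinity>")
  case True
  then have "AE \<omega> in M. \<bar>X \<omega>\<bar> \<le> a"
    using a Lp_norm_le_iff[OF X, of a] by simp
  then have "AE \<omega> in M. \<bar>t * X \<omega>\<bar> \<le> \<bar>t\<bar> * a"
    by eventually_elim (simp add: abs_mult mult_left_mono)
  then show ?thesis
    using True a by (subst Lp_norm_le_iff) auto
next
  case False
  let ?q = "enn2real p"
  have I: "(\<integral>\<^sup>+ \<omega>. ennreal (\<bar>X \<omega>\<bar> powr ?q) \<partial>M) \<le> ennreal (a powr ?q)"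
    using a Lp_norm_le_iff[OF X, of a] False by simp
  have "(\<integral>\<^sup>+ \<omega>. ennreal (\<bar>t * X \<omega>\<bar> powr ?q) \<partial>M)
      = (\<integral>\<^sup>+ \<omega>. ennreal (\<bar>t\<bar> powr ?q) * ennreal (\<bar>X \<omega>\<bar> powr ?q) \<partial>M)"
    by (simp add: abs_mult powr_mult ennreal_mult)
  also have "\<dots> = ennreal (\<bar>t\<bar> powr ?q) * (\<integral>\<^sup>+ \<omega>. ennreal (\<bar>X \<omega>\<bar> powr ?q) \<partial>M)"
    by (rule nn_integral_cmult) measurable
  also have "\<dots> \<le> ennreal (\<bar>t\<bar> powr ?q) * ennreal (a powr ?q)"
    using I by (rule mult_left_mono) auto
  also have "\<dots> = ennreal ((\<bar>t\<bar> * a) powr ?q)"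
    using a by (simp add: powr_mult ennreal_mult)
  finally show ?thesis
    using False a by (subst Lp_norm_le_iff) auto
qed

text \<open>A quasi-triangle inequality is enough here: only convergence matters.\<close>

lemma Lp_norm_add_le:
  assumes X [measurable]: "X \<in> borel_measurable M" and Y [measurable]: "Y \<in> borel_measurable M"
    and a: "0 \<le> a" "Lp_norm M p X \<le> ennreal a" and b: "0 \<le> b" "Lp_norm M p Y \<le> ennreal b"
  shows "Lp_norm M p (\<lambda>\<omega>. X \<omega> + Y \<omega>) \<le> ennreal (4 * (a + b))"
proof (cases "p = \<infinity>")
  case True
  then have "AE \<omega> in M. \<bar>X \<omega>\<bar> \<le> a" "AE \<omega> in M. \<bar>Y \<omega>\<bar> \<le> b"
    using a b Lp_norm_le_iff[OF X, of a] Lp_norm_le_iff[OF Y, of b] by simp_all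
  then have "AE \<omega> in M. \<bar>X \<omega> + Y \<omega>\<bar> \<le> 4 * (a + b)"
    by eventually_elim (use a b in auto)
  then show ?thesis
    using True a b by (subst Lp_norm_le_iff) auto
next
  case False
  let ?q = "enn2real p"
  have q: "1 \<le> ?q" using one_le_exponent[OF False] .
  have I: "(\<integral>\<^sup>+ \<omega>. ennreal (\<bar>X \<omega>\<bar> powr ?q) \<partial>M) \<le> ennreal (a powr ?q)"
      "(\<integral>\<^sup>+ \<omega>. ennreal (\<bar>Y \<omega>\<bar> powr ?q) \<partial>M) \<le> ennreal (b powr ?q)"
    using a b Lp_norm_le_iff[OF X, of a] Lp_norm_le_iff[OF Y, of b] False by simp_all
  have "(\<integral>\<^sup>+ \<omega>. ennreal (\<bar>X \<omega> + Y \<omega>\<bar> powr ?q) \<partial>M)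
      \<le> (\<integral>\<^sup>+ \<omega>. ennreal (2 powr ?q) *
            (ennreal (\<bar>X \<omega>\<bar> powr ?q) + ennreal (\<bar>Y \<omega>\<bar> powr ?q)) \<partial>M)"
    using q abs_add_powr_le[of ?q]
    by (intro nn_integral_mono) (simp flip: ennreal_mult ennreal_plus)
  also have "\<dots> = ennreal (2 powr ?q) * ((\<integral>\<^sup>+ \<omega>. ennreal (\<bar>X \<omega>\<bar> powr ?q) \<partial>M)
      + (\<integral>\<^sup>+ \<omega>. ennreal (\<bar>Y \<omega>\<bar> powr ?q) \<partial>M))"
    by (simp add: nn_integral_cmult nn_integral_add)
  also have "\<dots> \<le> ennreal (2 powr ?q) * (ennreal (a powr ?q) + ennreal (b powr ?q))"
    using I by (intro mult_left_mono add_mono) auto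
  also have "\<dots> = ennreal (2 powr ?q * (a powr ?q + b powr ?q))"
    by (simp flip: ennreal_mult ennreal_plus)
  also have "\<dots> \<le> ennreal ((4 * (a + b)) powr ?q)"
  proof (rule ennreal_leI)
    \<comment> \<open>One factor 2 of the constant 4 comes from \<open>abs_add_powr_le\<close>; the
      other absorbs the two equal summands, since \<open>2 \<le> 2 powr ?q\<close>.\<close>
    have "a powr ?q + b powr ?q \<le> (a + b) powr ?q + (a + b) powr ?q"
      using a b q by (intro add_mono powr_mono2) auto
    also have "\<dots> = 2 powr 1 * (a + b) powr ?q" by simp
    also have "\<dots> \<le> 2 powr ?q * (a + b) powr ?q"
      using q by (intro mult_right_mono powr_mono) auto
    finally have "2 powr ?q * (a powr ?q + b powr ?q) \<le> 2 powr ?q * (2 powr ?q * (a + b) powr ?q)"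
      by (intro mult_left_mono) auto
    also have "\<dots> = (2 * (2 * (a + b))) powr ?q"
      using a b by (simp only: powr_mult[symmetric])
    finally show "2 powr ?q * (a powr ?q + b powr ?q) \<le> (4 * (a + b)) powr ?q"
      by simp
  qed
  finally show ?thesis
    using False a b by (subst Lp_norm_le_iff) auto
qed

lemma Lp_const [simp]: "(\<lambda>_. c) \<in> Lp M p"
  by (rule LpI[OF _ Lp_norm_const_le]) simp

lemma Lp_scale: "X \<in> Lp M p \<Longrightarrow> (\<lambda>\<omega>. t * X \<omega>) \<in> Lp M p"
proof -
  assume X: "X \<in> Lp M p"
  note [measurable] = Lp_measurable[OF X]
  obtain a where "0 < a" "Lp_norm M p X \<le> ennreal a"
    using X by (rule Lp_normE)
  then show ?thesis
    by (intro LpI[OF _ Lp_norm_scale_le[of X a]]) auto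
qed

lemma Lp_add: "X \<in> Lp M p \<Longrightarrow> Y \<in> Lp M p \<Longrightarrow> (\<lambda>\<omega>. X \<omega> + Y \<omega>) \<in> Lp M p"
proof -
  assume X: "X \<in> Lp M p" and Y: "Y \<in> Lp M p"
  note [measurable] = Lp_measurable[OF X] Lp_measurable[OF Y]
  obtain a b where "0 < a" "Lp_norm M p X \<le> ennreal a" "0 < b" "Lp_norm M p Y \<le> ennreal b"
    using X Y by (meson Lp_normE)
  then show ?thesis
    by (intro LpI[OF _ Lp_norm_add_le[of X Y a b]]) auto
qed

lemma Lp_diff_const: "X \<in> Lp M p \<Longrightarrow> (\<lambda>\<omega>. X \<omega> - c) \<in> Lp M p"
  using Lp_add[of X "\<lambda>_. - c"] by simp

text \<open>Off \<open>{\<bar>X\<bar> \<le> a}\<close> one has \<open>\<bar>X\<bar> \<le> a\<^sup>1\<^sup>-\<^sup>p \<bar>X\<bar>\<^sup>p\<close>; this gives the bound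
  without appealing to Hoelder's inequality.\<close>

lemma Lp_expectation_bound:
  assumes X [measurable]: "X \<in> borel_measurable M" and a: "0 < a" "Lp_norm M p X \<le> ennreal a"
  shows "integrable M X" "\<bar>expectation X\<bar> \<le> 2 * a"
proof -
  have "(\<integral>\<^sup>+ \<omega>. ennreal (norm (X \<omega>)) \<partial>M) \<le> ennreal (2 * a)"
  proof (cases "p = \<infinity>")
    case True
    then have "AE \<omega> in M. \<bar>X \<omega>\<bar> \<le> a"
      using a Lp_norm_le_iff[OF X, of a] by simp
    then have "(\<integral>\<^sup>+ \<omega>. ennreal (norm (X \<omega>)) \<partial>M) \<le> (\<integral>\<^sup>+ \<omega>. ennreal (2 * a) \<partial>M)"
      by (intro nn_integral_mono_AE, eventually_elim) (use a in \<open>auto intro: ennreal_leI\<close>)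
    then show ?thesis by (simp add: emeasure_space_1)
  next
    case False
    let ?q = "enn2real p"
    have q: "1 \<le> ?q" using one_le_exponent[OF False] .
    have pw: "\<bar>x\<bar> \<le> a + a powr (1 - ?q) * \<bar>x\<bar> powr ?q" for x
    proof (cases "\<bar>x\<bar> \<le> a")
      case True
      then show ?thesis by (simp add: add_increasing2)
    next
      case False
      then have "\<bar>x\<bar> = \<bar>x\<bar> powr (1 - ?q) * \<bar>x\<bar> powr ?q"
        using a by (simp flip: powr_add)
      also have "\<dots> \<le> a powr (1 - ?q) * \<bar>x\<bar> powr ?q"
        using False a q by (intro mult_right_mono powr_mono2') auto
      finally show ?thesis using a by linarith
    qed
    have I: "(\<integral>\<^sup>+ \<omega>. ennreal (\<bar>X \<omega>\<bar> powr ?q) \<partial>M) \<le> ennreal (a powr ?q)"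
      using a Lp_norm_le_iff[OF X, of a] False by simp
    have "(\<integral>\<^sup>+ \<omega>. ennreal (norm (X \<omega>)) \<partial>M)
        \<le> (\<integral>\<^sup>+ \<omega>. ennreal a + ennreal (a powr (1 - ?q)) * ennreal (\<bar>X \<omega>\<bar> powr ?q) \<partial>M)"
      using pw a by (intro nn_integral_mono) (simp flip: ennreal_mult ennreal_plus)
    also have "\<dots> = ennreal a + ennreal (a powr (1 - ?q)) * (\<integral>\<^sup>+ \<omega>. ennreal (\<bar>X \<omega>\<bar> powr ?q) \<partial>M)"
      by (simp add: nn_integral_cmult nn_integral_add emeasure_space_1)
    also have "\<dots> \<le> ennreal a + ennreal (a powr (1 - ?q)) * ennreal (a powr ?q)"
      using I by (intro mult_left_mono add_mono) auto
    also have "\<dots> = ennreal (2 * a)"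
      using a by (simp flip: ennreal_mult ennreal_plus powr_add)
    finally show ?thesis .
  qed
  then show int: "integrable M X"
    by (intro integrableI_bounded) (auto intro: le_less_trans)
  have "ennreal (norm (expectation X)) \<le> ennreal (2 * a)"
    using integral_norm_bound_ennreal[OF int] \<open>_ \<le> ennreal (2 * a)\<close> by (rule order_trans)
  then show "\<bar>expectation X\<bar> \<le> 2 * a"
    using a by (simp add: ennreal_le_iff)
qed

lemma Lp_integrable: "X \<in> Lp M p \<Longrightarrow> integrable M X"
  by (meson Lp_expectation_bound(1) Lp_measurable Lp_normE)

lemma expectation_diff_const: "X \<in> Lp M p \<Longrightarrow> expectation (\<lambda>\<omega>. X \<omega> - c) = expectation X - c"
  using Lp_integrable[of X] by (simp add: prob_space)


section \<open>Sequential convergence and lower semicontinuity\<close>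

definition Lp_lim :: "(nat \<Rightarrow> 'a \<Rightarrow> real) \<Rightarrow> ('a \<Rightarrow> real) \<Rightarrow> bool" where
  "Lp_lim X x \<longleftrightarrow> (\<forall>n. X n \<in> Lp M p) \<and> x \<in> Lp M p \<and>
     (\<forall>\<epsilon>>0. \<forall>\<^sub>F n in sequentially. Lp_norm M p (\<lambda>\<omega>. X n \<omega> - x \<omega>) \<le> ennreal \<epsilon>)"

lemma Lp_lim_const: "x \<in> Lp M p \<Longrightarrow> Lp_lim (\<lambda>_. x) x"
  using Lp_norm_const_le[of 0] unfolding Lp_lim_def by (auto intro: order_trans)

lemma Lp_lim_subseq: "Lp_lim X x \<Longrightarrow> strict_mono s \<Longrightarrow> Lp_lim (X \<circ> s) x"
  unfolding Lp_lim_def by (auto simp: o_def intro: eventually_subseq)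

lemma Lp_lim_diff_const:
  assumes X: "Lp_lim X x" and c: "c \<longlonglongrightarrow> d"
  shows "Lp_lim (\<lambda>n \<omega>. X n \<omega> - c n) (\<lambda>\<omega>. x \<omega> - d)"
  unfolding Lp_lim_def
proof (intro conjI allI impI)
  fix \<epsilon> :: real assume e: "0 < \<epsilon>"
  \<comment> \<open>The quasi-triangle inequality has factor 4 and two terms are added, hence
    \<open>\<epsilon> / 8\<close>.\<close>
  have "\<forall>\<^sub>F n in sequentially. \<bar>c n - d\<bar> < \<epsilon> / 8"
    using tendstoD[OF c, of "\<epsilon> / 8"] e by (simp add: dist_real_def)
  moreover have "\<forall>\<^sub>F n in sequentially. Lp_norm M p (\<lambda>\<omega>. X n \<omega> - x \<omega>) \<le> ennreal (\<epsilon> / 8)"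
    using X e unfolding Lp_lim_def by simp
  ultimately show "\<forall>\<^sub>F n in sequentially. Lp_norm M p (\<lambda>\<omega>. (X n \<omega> - c n) - (x \<omega> - d)) \<le> ennreal \<epsilon>"
  proof eventually_elim
    case (elim n)
    have [measurable]: "X n \<in> borel_measurable M" "x \<in> borel_measurable M"
      using X Lp_measurable by (auto simp: Lp_lim_def)
    have "Lp_norm M p (\<lambda>_. d - c n) \<le> ennreal (\<epsilon> / 8)"
      by (rule order_trans[OF Lp_norm_const_le]) (use elim(1) in \<open>intro ennreal_leI, linarith\<close>)
    from Lp_norm_add_le[OF _ _ _ elim(2) _ this] e
    have "Lp_norm M p (\<lambda>\<omega>. (X n \<omega> - x \<omega>) + (d - c n)) \<le> ennreal (4 * (\<epsilon> / 8 + \<epsilon> / 8))"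
      by simp
    then show ?case by (simp add: algebra_simps)
  qed
qed (use X in \<open>auto simp: Lp_lim_def Lp_diff_const\<close>)

lemma Lp_lim_expectation:
  assumes X: "Lp_lim X x"
  shows "(\<lambda>n. expectation (X n)) \<longlonglongrightarrow> expectation x"
proof (rule tendstoI)
  fix \<epsilon> :: real assume e: "0 < \<epsilon>"
  \<comment> \<open>The expectation bound doubles the norm bound; a third leaves a strict
    inequality.\<close>
  then have "\<forall>\<^sub>F n in sequentially. Lp_norm M p (\<lambda>\<omega>. X n \<omega> - x \<omega>) \<le> ennreal (\<epsilon> / 3)"
    using X unfolding Lp_lim_def by simp
  then show "\<forall>\<^sub>F n in sequentially. dist (expectation (X n)) (expectation x) < \<epsilon>"
  proof eventually_elim
    case (elim n)
    have Lp: "X n \<in> Lp M p" "x \<in> Lp M p" using X by (auto simp: Lp_lim_def)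
    note [measurable] = Lp[THEN Lp_measurable]
    have "\<bar>expectation (\<lambda>\<omega>. X n \<omega> - x \<omega>)\<bar> \<le> 2 * (\<epsilon> / 3)"
      using e elim by (intro Lp_expectation_bound(2)) auto
    then show ?case
      using Lp[THEN Lp_integrable] e by (simp add: dist_real_def)
  qed
qed

text \<open>For a real \<open>C\<close> strictly between \<open>y\<close> and \<open>F x\<close>,
  the complement of the sublevel set at \<open>C\<close> is a neighbourhood of \<open>x\<close>.
  Closedness enters the later arguments only in this sequential form.\<close>

lemma closed_functional_lsc:
  assumes F: "closed_functional M p F" and X: "Lp_lim X x" and y: "y < F x"
  shows "\<forall>\<^sub>F n in sequentially. y < F (X n)"
proof -
  obtain C where C: "y < ereal C" "ereal C < F x"
    using ereal_dense2[OF y] by blast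
  have "openin (Lp_topology M p) (Lp M p - {X \<in> Lp M p. F X \<le> ereal C})"
    using F unfolding closed_functional_def closedin_def by auto
  moreover have "x \<in> Lp M p - {X \<in> Lp M p. F X \<le> ereal C}"
    using X C by (auto simp: Lp_lim_def)
  ultimately obtain \<epsilon> where e: "0 < \<epsilon>"
    "\<And>Y. Y \<in> Lp M p \<Longrightarrow> Lp_norm M p (\<lambda>\<omega>. Y \<omega> - x \<omega>) < ennreal \<epsilon> \<Longrightarrow> Y \<in> Lp M p - {X \<in> Lp M p. F X \<le> ereal C}"
    unfolding openin_Lp_topology by blast
  have "\<forall>\<^sub>F n in sequentially. Lp_norm M p (\<lambda>\<omega>. X n \<omega> - x \<omega>) \<le> ennreal (\<epsilon> / 2)"
    using X e unfolding Lp_lim_def by simp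
  then show ?thesis
  proof eventually_elim
    case (elim n)
    also have "ennreal (\<epsilon> / 2) < ennreal \<epsilon>" using e by (simp add: ennreal_lessI)
    finally show ?case
      using e(2)[of "X n"] X C by (auto simp: Lp_lim_def not_le intro: less_trans)
  qed
qed

text \<open>If the complement of a sublevel set is not open at \<open>x\<close>, the balls of radius
  \<open>1 / real (Suc n)\<close> supply members of the sublevel set that converge to
  \<open>x\<close>.\<close>

lemma closed_functionalI:
  assumes *: "\<And>X x C. Lp_lim X x \<Longrightarrow> (\<And>n. F (X n) \<le> ereal C) \<Longrightarrow> F x \<le> ereal C"
  shows "closed_functional M p F"
  unfolding closed_functional_def closedin_def topspace_Lp_topology openin_Lp_topology
proof (intro allI conjI ballI)
  fix C x assume x: "x \<in> Lp M p - {X \<in> Lp M p. F X \<le> ereal C}"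
  let ?U = "Lp M p - {X \<in> Lp M p. F X \<le> ereal C}"
  show "\<exists>\<epsilon>>0. \<forall>Y\<in>Lp M p. Lp_norm M p (\<lambda>\<omega>. Y \<omega> - x \<omega>) < ennreal \<epsilon> \<longrightarrow> Y \<in> ?U"
  proof (rule ccontr)
    assume neg: "\<not> ?thesis"
    have "\<exists>Y. Y \<in> Lp M p \<and> Lp_norm M p (\<lambda>\<omega>. Y \<omega> - x \<omega>) < ennreal (1 / real (Suc n)) \<and> Y \<notin> ?U" for n
    proof -
      have "0 < 1 / real (Suc n)" by simp
      with neg show ?thesis by blast
    qed
    then have "\<exists>X. \<forall>n. X n \<in> Lp M p \<and>
        Lp_norm M p (\<lambda>\<omega>. X n \<omega> - x \<omega>) < ennreal (1 / real (Suc n)) \<and> X n \<notin> ?U"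
      by (intro choice) blast
    then obtain X where X: "\<And>n. X n \<in> Lp M p" "\<And>n. X n \<notin> ?U"
      "\<And>n. Lp_norm M p (\<lambda>\<omega>. X n \<omega> - x \<omega>) < ennreal (1 / real (Suc n))"
      by blast
    have "Lp_lim X x"
      unfolding Lp_lim_def
    proof (intro conjI allI impI)
      fix \<epsilon> :: real assume "0 < \<epsilon>"
      then have "\<forall>\<^sub>F n in sequentially. inverse (real (Suc n)) < \<epsilon>"
        using LIMSEQ_inverse_real_of_nat by (rule order_tendstoD[rotated])
      then show "\<forall>\<^sub>F n in sequentially. Lp_norm M p (\<lambda>\<omega>. X n \<omega> - x \<omega>) \<le> ennreal \<epsilon>"
      proof eventually_elim
        case (elim n)
        then show ?case
          using X(3)[of n] ennreal_leI[of "1 / real (Suc n)" \<epsilon>] by (simp add: inverse_eq_divide del: of_nat_Suc)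
      qed
    qed (use X x in auto)
    from *[OF this, of C] X x show False by blast
  qed
qed auto

end


section \<open>Weighted sums and minima of extended reals\<close>

text \<open>Bolzano-Weierstrass is applied to one coordinate at a time; passing to a further
  subsequence keeps the limits already obtained.\<close>

lemma finite_bounded_convergent_subseq:
  fixes c :: "nat \<Rightarrow> 'i \<Rightarrow> real"
  assumes "finite A" "\<And>k. k \<in> A \<Longrightarrow> bounded (range (\<lambda>n. c n k))"
  shows "\<exists>s. strict_mono s \<and> (\<forall>k\<in>A. convergent (\<lambda>n. c (s n) k))"
  using assms
proof (induction A rule: finite_induct)
  case empty
  then show ?case by (auto intro: strict_mono_id)
next
  case (insert i A)
  then obtain s where s: "strict_mono s" "\<forall>k\<in>A. convergent (\<lambda>n. c (s n) k)"
    by auto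
  have "bounded (range (\<lambda>n. c (s n) i))"
    by (rule bounded_subset[OF insert.prems[of i]]) auto
  then obtain l u where u: "strict_mono u" "((\<lambda>n. c (s n) i) \<circ> u) \<longlonglongrightarrow> l"
    using bounded_imp_convergent_subsequence by blast
  have "convergent (\<lambda>n. c (s (u n)) k)" if "k \<in> insert i A" for k
  proof (cases "k = i")
    case True
    with u show ?thesis by (auto simp: convergent_def o_def)
  next
    case False
    with that s have "convergent (\<lambda>n. c (s n) k)" by auto
    from convergent_subseq_convergent[OF this u(1)] show ?thesis by (simp add: o_def)
  qed
  then show ?case
    using strict_mono_o[OF s(1) u(1)] by (auto simp: o_def intro!: exI[of _ "s \<circ> u"])
qed

lemma nonneg_ereal_le_sum:
  fixes f :: "'i \<Rightarrow> ereal"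
  assumes "finite A" "k \<in> A" "\<And>j. j \<in> A \<Longrightarrow> 0 \<le> f j"
  shows "f k \<le> sum f A"
  using sum_mono2[of A "{k}" f] assms by auto

text \<open>The limit inferior is superadditive on nonnegative terms, so termwise lower
  semicontinuity survives summation even with infinite values. The hypothesis on \<open>L\<close>
  has the shape delivered by \<open>closed_functional_lsc\<close>; the varying bound
  \<open>a n\<close> serves minimizing sequences.\<close>

lemma weighted_sum_le_lim:
  fixes f :: "'i \<Rightarrow> nat \<Rightarrow> ereal"
  assumes "finite A" and w: "\<And>k. k \<in> A \<Longrightarrow> 0 \<le> w k"
    and f: "\<And>k n. k \<in> A \<Longrightarrow> 0 \<le> f k n"
    and L: "\<And>k y. k \<in> A \<Longrightarrow> y < L k \<Longrightarrow> \<forall>\<^sub>F n in sequentially. y < f k n"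
    and le: "\<And>n. (\<Sum>k\<in>A. ereal (w k) * f k n) \<le> ereal (a n)" and a: "a \<longlonglongrightarrow> b"
  shows "(\<Sum>k\<in>A. ereal (w k) * L k) \<le> ereal b"
proof -
  have wL: "ereal (w k) * L k \<le> liminf (\<lambda>n. ereal (w k) * f k n)" if "k \<in> A" for k
  proof -
    have "L k \<le> liminf (f k)" using L[OF that] by (simp add: le_Liminf_iff)
    then show ?thesis
      using w[OF that] by (subst Liminf_ereal_mult_left) (auto intro: ereal_mult_left_mono)
  qed
  have "(\<Sum>k\<in>A. ereal (w k) * L k) \<le> liminf (\<lambda>n. \<Sum>k\<in>A. ereal (w k) * f k n)"
    using \<open>finite A\<close> w f wL
  proof (induction A rule: finite_induct)
    case (insert i A)
    have "(\<Sum>k\<in>insert i A. ereal (w k) * L k)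
        \<le> liminf (\<lambda>n. ereal (w i) * f i n) + liminf (\<lambda>n. \<Sum>k\<in>A. ereal (w k) * f k n)"
      using insert by (simp add: add_mono)
    also have "\<dots> \<le> liminf (\<lambda>n. ereal (w i) * f i n + (\<Sum>k\<in>A. ereal (w k) * f k n))"
      using insert.prems by (intro Liminf_add_le) (auto intro!: always_eventually sum_nonneg)
    finally show ?case using insert.hyps by simp
  qed (simp add: Liminf_const)
  also have "\<dots> \<le> liminf (\<lambda>n. ereal (a n))"
    using le by (intro Liminf_mono always_eventually) auto
  also have "\<dots> = ereal b"
    using a by (intro lim_imp_Liminf) auto
  finally show ?thesis .
qed

text \<open>Nonnegativity makes the distributive laws valid for extended reals, where terms may be
  infinite.\<close>

lemma weighted_sum_convex_le:
  fixes x y z :: "'i \<Rightarrow> ereal"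
  assumes w: "\<And>k. k \<in> A \<Longrightarrow> 0 \<le> w k" and t: "0 < t" "t < 1"
    and nonneg: "\<And>k. k \<in> A \<Longrightarrow> 0 \<le> x k" "\<And>k. k \<in> A \<Longrightarrow> 0 \<le> y k"
    and z: "\<And>k. k \<in> A \<Longrightarrow> z k \<le> ereal (1 - t) * x k + ereal t * y k"
  shows "(\<Sum>k\<in>A. ereal (w k) * z k) \<le>
    ereal (1 - t) * (\<Sum>k\<in>A. ereal (w k) * x k) + ereal t * (\<Sum>k\<in>A. ereal (w k) * y k)"
proof -
  have "(\<Sum>k\<in>A. ereal (w k) * z k)
      \<le> (\<Sum>k\<in>A. ereal (1 - t) * (ereal (w k) * x k) + ereal t * (ereal (w k) * y k))"
  proof (rule sum_mono)
    fix k assume k: "k \<in> A"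
    have "ereal (w k) * z k \<le> ereal (w k) * (ereal (1 - t) * x k + ereal t * y k)"
      using w z k by (intro ereal_mult_left_mono) auto
    also have "\<dots> = ereal (w k) * (ereal (1 - t) * x k) + ereal (w k) * (ereal t * y k)"
      using nonneg k t by (intro ereal_right_distrib) auto
    also have "\<dots> = ereal (1 - t) * (ereal (w k) * x k) + ereal t * (ereal (w k) * y k)"
      by (simp only: mult.left_commute)
    finally show "ereal (w k) * z k \<le> \<dots>" .
  qed
  also have "\<dots> = ereal (1 - t) * (\<Sum>k\<in>A. ereal (w k) * x k) + ereal t * (\<Sum>k\<in>A. ereal (w k) * y k)"
    using w nonneg by (simp add: sum.distrib sum_ereal_right_distrib)
  finally show ?thesis .
qed

text \<open>Finiteness of all \<open>x k\<close> makes both sums finite, hence every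
  \<open>y k\<close> as well; over the reals, equal sums of ordered terms with positive weights
  agree termwise. This turns optimality of a tuple of shifts into optimality of each shift.\<close>

lemma weighted_sum_eq_imp_eq:
  fixes x y :: "'i \<Rightarrow> ereal"
  assumes A: "finite A" and w: "\<And>k. k \<in> A \<Longrightarrow> 0 < w k"
    and x: "\<And>k. k \<in> A \<Longrightarrow> 0 \<le> x k" "\<And>k. k \<in> A \<Longrightarrow> x k \<noteq> \<infinity>"
    and le: "\<And>k. k \<in> A \<Longrightarrow> x k \<le> y k"
    and eq: "(\<Sum>k\<in>A. ereal (w k) * x k) = (\<Sum>k\<in>A. ereal (w k) * y k)" and k: "k \<in> A"
  shows "x k = y k"
proof -
  define u v where "u k = real_of_ereal (x k)" and "v k = real_of_ereal (y k)" for k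
  have xu: "x j = ereal (u j)" if "j \<in> A" for j
    using x[OF that] by (cases "x j") (auto simp: u_def)
  have "(\<Sum>k\<in>A. ereal (w k) * x k) = ereal (\<Sum>k\<in>A. w k * u k)"
    by (simp add: xu)
  then have "(\<Sum>k\<in>A. ereal (w k) * y k) \<noteq> \<infinity>" using eq by simp
  then have "ereal (w j) * y j \<noteq> \<infinity>" if "j \<in> A" for j
    using that A by (auto simp: sum_Pinfty)
  then have yv: "y j = ereal (v j)" if "j \<in> A" for j
    using that w[OF that] x(1)[OF that] le[OF that] by (cases "y j") (auto simp: v_def)
  have uv: "u j \<le> v j" if "j \<in> A" for j
    using le[OF that] by (simp add: xu yv that)
  have "(\<Sum>k\<in>A. w k * u k) = (\<Sum>k\<in>A. w k * v k)"
    using eq by (simp add: xu yv)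
  then have "w k * u k = w k * v k"
    using A k uv w by (intro sum_mono_inv[of "\<lambda>k. w k * u k" A "\<lambda>k. w k * v k"])
      (auto intro!: mult_left_mono less_imp_le)
  then show ?thesis using w[OF k] k by (simp add: xu yv)
qed

section \<open>Attained minima and sets of minimizers\<close>

lemma is_min_ofI: "P x \<Longrightarrow> (\<And>y. P y \<Longrightarrow> f x \<le> f y) \<Longrightarrow> m = f x \<Longrightarrow> is_min_of m f P"
  unfolding is_min_of_def is_arg_min_def by (metis not_le)

lemma is_min_ofE:
  assumes "is_min_of m f P"
  obtains x where "P x" "m = f x" "\<And>y. P y \<Longrightarrow> f x \<le> f y"
  using assms unfolding is_min_of_def is_arg_min_def by (metis not_le)

text \<open>For fixed \<open>X\<close> the objectives for regret and error differ by the real number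
  \<open>expectation X\<close>, so this and \<open>argmin_set_add\<close> carry minima and
  minimizers from one to the other.\<close>

lemma is_min_of_add:
  assumes "is_min_of m f P" "\<And>x. P x \<Longrightarrow> g x = f x + ereal e" "n = m + ereal e"
  shows "is_min_of n g P"
  using assms(1) by (rule is_min_ofE) (auto intro!: is_min_ofI add_mono simp: assms(2,3))

lemma argmin_set_add:
  assumes "\<And>x. g x = f x + ereal e"
  shows "argmin_set g = argmin_set f"
proof -
  have "a + ereal e < b + ereal e \<longleftrightarrow> a < b" for a b
    by (cases a; cases b) auto
  then show ?thesis
    unfolding argmin_set_def is_arg_min_def assms by simp
qed

lemma argmin_set_eq:
  assumes "is_min_of m f (\<lambda>_. True)"
  shows "argmin_set f = {x. f x = m}"
proof -
  from assms obtain x0 where "m = f x0" "\<And>y. f x0 \<le> f y" by (rule is_min_ofE) auto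
  then show ?thesis
    unfolding argmin_set_def is_arg_min_def by (auto simp: not_less intro: antisym)
qed


section \<open>Functionals and coercivity of errors\<close>

context prob_Lp
begin

lemma Lp_functional_cong:
  assumes "Lp_functional M p F" "X \<in> Lp M p" "Y \<in> Lp M p" "AE \<omega> in M. X \<omega> = Y \<omega>"
  shows "F X = F Y"
  using assms unfolding Lp_functional_def by blast

lemma monotone_functionalD:
  assumes "monotone_functional M p F" "X \<in> Lp M p" "Y \<in> Lp M p" "AE \<omega> in M. X \<omega> \<le> Y \<omega>"
  shows "F X \<le> F Y"
  using assms unfolding monotone_functional_def by blast

lemma convex_functionalD:
  assumes "convex_functional M p F" "X \<in> Lp M p" "Y \<in> Lp M p" "0 < t" "t < 1"
  shows "F (\<lambda>\<omega>. (1 - t) * X \<omega> + t * Y \<omega>) \<le> ereal (1 - t) * F X + ereal t * F Y"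
  using assms unfolding convex_functional_def by blast

text \<open>The expectation is finite, linear and continuous along \<open>Lp_lim\<close>, so adding
  it disturbs none of the three properties.\<close>

lemma functional_add_expectation:
  assumes F: "Lp_functional M p F" "closed_functional M p F" "convex_functional M p F"
    and G: "\<And>X. X \<in> Lp M p \<Longrightarrow> G X = F X + ereal (expectation X)"
  shows "Lp_functional M p G" "closed_functional M p G" "convex_functional M p G"
proof -
  show "Lp_functional M p G"
    unfolding Lp_functional_def
  proof (intro conjI ballI impI)
    fix X assume X: "X \<in> Lp M p"
    then have "F X \<noteq> - \<infinity>" using F(1) unfolding Lp_functional_def by blast
    then show "G X \<noteq> - \<infinity>" by (simp add: G[OF X])
  next
    fix X Y assume XY: "X \<in> Lp M p" "Y \<in> Lp M p" "AE \<omega> in M. X \<omega> = Y \<omega>"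
    then have "expectation X = expectation Y"
      by (intro integral_cong_AE) (auto simp: Lp_measurable)
    moreover have "F X = F Y" using F(1) XY by (rule Lp_functional_cong)
    ultimately show "G X = G Y" using XY by (simp add: G)
  qed
  show "closed_functional M p G"
  proof (rule closed_functionalI, rule ccontr)
    fix X x C assume X: "Lp_lim X x" and le: "\<And>n. G (X n) \<le> ereal C" and "\<not> G x \<le> ereal C"
    then have "ereal (C - expectation x) < F x"
      using G[of x] by (cases "F x") (auto simp: Lp_lim_def)
    \<comment> \<open>The number \<open>b\<close> separates the limits: eventually
      \<open>F (X n)\<close> lies above \<open>b\<close> and \<open>C - expectation (X n)\<close>
      below it, contradicting \<open>G (X n) \<le> ereal C\<close>.\<close>
    then obtain b where b: "C - expectation x < b" "ereal b < F x"
      using ereal_dense2 by force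
    have "\<forall>\<^sub>F n in sequentially. ereal b < F (X n)"
      using closed_functional_lsc[OF F(2) X b(2)] .
    moreover have "\<forall>\<^sub>F n in sequentially. C - expectation (X n) < b"
      by (rule order_tendstoD(2)[OF tendsto_diff[OF tendsto_const Lp_lim_expectation[OF X]] b(1)])
    ultimately have "\<forall>\<^sub>F n in sequentially. False"
    proof eventually_elim
      case (elim n)
      then show ?case
        using le[of n] G[of "X n"] X by (cases "F (X n)") (auto simp: Lp_lim_def)
    qed
    then show False by simp
  qed
  show "convex_functional M p G"
    unfolding convex_functional_def
  proof (intro ballI allI impI)
    fix X Y t assume XY: "X \<in> Lp M p" "Y \<in> Lp M p" and t: "0 < t \<and> t < (1::real)"
    let ?Z = "\<lambda>\<omega>. (1 - t) * X \<omega> + t * Y \<omega>"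
    have Z: "?Z \<in> Lp M p" using XY by (intro Lp_add Lp_scale)
    have "expectation ?Z = (1 - t) * expectation X + t * expectation Y"
      using XY[THEN Lp_integrable] by simp
    moreover have "F ?Z \<le> ereal (1 - t) * F X + ereal t * F Y"
      using convex_functionalD[OF F(3) XY] t by blast
    moreover have "F X \<noteq> -\<infinity>" "F Y \<noteq> -\<infinity>" "F ?Z \<noteq> -\<infinity>"
      using F(1) XY Z unfolding Lp_functional_def by blast+
    ultimately show "G ?Z \<le> ereal (1 - t) * G X + ereal t * G Y"
      unfolding G[OF Z] G[OF XY(1)] G[OF XY(2)] using t
      by (cases "F X"; cases "F Y"; cases "F ?Z") (auto simp: algebra_simps)
  qed
qed

text \<open>After the expectation is subtracted, each condition on a risk becomes one on a
  deviation. Together with \<open>subregular_regret_of_error\<close> this leaves only mixtures of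
  deviations and errors to be treated directly.\<close>

lemma subregular_risk_of_deviation:
  assumes D: "subregular_deviation M p D"
    and R: "\<And>X. X \<in> Lp M p \<Longrightarrow> R X = D X + ereal (expectation X)"
  shows "subregular_risk M p R"
proof -
  note D = D[unfolded subregular_deviation_def]
  have "\<exists>t>0. R (\<lambda>\<omega>. t * X \<omega>) > ereal (\<integral>\<omega>. t * X \<omega> \<partial>M)"
    if X: "X \<in> Lp M p" "\<not> ae_constant M X" for X
  proof -
    obtain t where "0 < t" "D (\<lambda>\<omega>. t * X \<omega>) > 0" using D X by blast
    then show ?thesis
      using R[OF Lp_scale[OF X(1), of t]] by (cases "D (\<lambda>\<omega>. t * X \<omega>)") (auto intro!: exI[of _ t])
  qed
  moreover have "R X \<ge> ereal (expectation X)" if "X \<in> Lp M p" for X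
    using D that R[OF that] by (simp add: add_increasing)
  ultimately show ?thesis
    unfolding subregular_risk_def using D R functional_add_expectation[of D R]
    by (auto simp: prob_space)
qed

lemma subregular_regret_of_error:
  assumes E: "subregular_error M p E"
    and V: "\<And>X. X \<in> Lp M p \<Longrightarrow> V X = E X + ereal (expectation X)"
  shows "subregular_regret M p V"
proof -
  note E = E[unfolded subregular_error_def]
  have "\<exists>t>0. V (\<lambda>\<omega>. t * X \<omega>) > ereal (\<integral>\<omega>. t * X \<omega> \<partial>M)"
    if X: "X \<in> Lp M p" "\<not> ae_zero M X" for X
  proof -
    obtain t where "0 < t" "E (\<lambda>\<omega>. t * X \<omega>) > 0" using E X by blast
    then show ?thesis
      using V[OF Lp_scale[OF X(1), of t]] by (cases "E (\<lambda>\<omega>. t * X \<omega>)") (auto intro!: exI[of _ t])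
  qed
  moreover have "V X \<ge> ereal (expectation X)" if "X \<in> Lp M p" for X
    using E that V[OF that] by (simp add: add_increasing)
  ultimately show ?thesis
    unfolding subregular_regret_def using E V functional_add_expectation[of E V]
    by (auto simp: prob_space)
qed

lemma pos_homogeneous_add_expectation:
  assumes F: "pos_homogeneous M p F" and nonneg: "\<And>X. X \<in> Lp M p \<Longrightarrow> 0 \<le> F X"
    and G: "\<And>X. X \<in> Lp M p \<Longrightarrow> G X = F X + ereal (expectation X)"
  shows "pos_homogeneous M p G"
  unfolding pos_homogeneous_def
proof (intro ballI allI impI)
  fix X t assume X: "X \<in> Lp M p" and t: "0 < (t::real)"
  have "F (\<lambda>\<omega>. t * X \<omega>) = ereal t * F X"
    using F X t by (simp add: pos_homogeneous_def)
  then show "G (\<lambda>\<omega>. t * X \<omega>) = ereal t * G X"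
    using nonneg[OF X] t unfolding G[OF X] G[OF Lp_scale[OF X]]
    by (cases "F X") (auto simp: algebra_simps)
qed

text \<open>The inequality for the scalar \<open>1 / t\<close> at \<open>t * X\<close> is the
  reverse inequality. When \<open>F\<close> is a minimum, it therefore suffices to exhibit one
  competitor.\<close>

lemma pos_homogeneousI:
  assumes *: "\<And>X t. X \<in> Lp M p \<Longrightarrow> 0 < t \<Longrightarrow> F (\<lambda>\<omega>. t * X \<omega>) \<le> ereal t * F X"
  shows "pos_homogeneous M p F"
  unfolding pos_homogeneous_def
proof (intro ballI allI impI antisym)
  fix X t assume X: "X \<in> Lp M p" and t: "0 < (t::real)"
  show "F (\<lambda>\<omega>. t * X \<omega>) \<le> ereal t * F X" using * X t .
  have "F (\<lambda>\<omega>. (1 / t) * (t * X \<omega>)) \<le> ereal (1 / t) * F (\<lambda>\<omega>. t * X \<omega>)"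
    using t X by (intro * Lp_scale) auto
  then have "ereal t * F X \<le> ereal t * (ereal (1 / t) * F (\<lambda>\<omega>. t * X \<omega>))"
    using t by (intro ereal_mult_left_mono) auto
  then show "ereal t * F X \<le> F (\<lambda>\<omega>. t * X \<omega>)"
    using t by (simp flip: mult.assoc)
qed

section \<open>Coercivity of errors in constant shifts\<close>

text \<open>The sign \<open>\<sigma>\<close> selects the direction: \<open>1\<close> gives an upper
  bound on the shifts, \<open>- 1\<close> a lower one.\<close>

lemma subregular_error_shift_bound_aux:
  assumes E: "subregular_error M p E" and K: "0 \<le> K" and a: "0 \<le> a" and \<sigma>: "\<sigma> = 1 \<or> \<sigma> = - (1::real)"
  shows "\<exists>B. \<forall>X\<in>Lp M p. \<forall>c. Lp_norm M p X \<le> ennreal K \<longrightarrow> E (\<lambda>\<omega>. X \<omega> - c) \<le> ereal a \<longrightarrow> \<sigma> * c \<le> B"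
proof (rule ccontr)
  assume neg: "\<not> ?thesis"
  note E = E[unfolded subregular_error_def]
  \<comment> \<open>The rescaled variables \<open>Y n\<close> below converge to the constant
    \<open>t * - \<sigma>\<close>. Subregularity makes the error positive there for some
    \<open>t\<close>, and \<open>b\<close> records the gap.\<close>
  have "\<not> ae_zero M (\<lambda>_. - \<sigma>)"
    using \<sigma> by (auto simp: ae_zero_def AE_const)
  then obtain t where t: "0 < t" "E (\<lambda>_. t * - \<sigma>) > 0"
    using E Lp_const[of "- \<sigma>"] by blast
  obtain b where b: "0 < b" "ereal b < E (\<lambda>_. t * - \<sigma>)"
    using ereal_dense2[OF t(2)] by auto
  \<comment> \<open>The summand \<open>t\<close> forces \<open>s n < 1\<close>, as convexity
    requires; \<open>real (Suc n)\<close> forces \<open>s n\<close> to tend to 0.\<close>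
  have "\<exists>Xc. fst Xc \<in> Lp M p \<and> Lp_norm M p (fst Xc) \<le> ennreal K \<and>
      E (\<lambda>\<omega>. fst Xc \<omega> - snd Xc) \<le> ereal a \<and> \<sigma> * snd Xc > t + real (Suc n)" for n
    using neg by (force simp: not_le)
  then have "\<exists>f. \<forall>n. fst (f n) \<in> Lp M p \<and> Lp_norm M p (fst (f n)) \<le> ennreal K \<and>
      E (\<lambda>\<omega>. fst (f n) \<omega> - snd (f n)) \<le> ereal a \<and> \<sigma> * snd (f n) > t + real (Suc n)"
    by (intro choice) blast
  then obtain f where f: "\<And>n. fst (f n) \<in> Lp M p" "\<And>n. Lp_norm M p (fst (f n)) \<le> ennreal K"
      "\<And>n. E (\<lambda>\<omega>. fst (f n) \<omega> - snd (f n)) \<le> ereal a" "\<And>n. \<sigma> * snd (f n) > t + real (Suc n)"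
    by blast
  define X c s where "X n = fst (f n)" and "c n = snd (f n)" and "s n = t / (\<sigma> * c n)" for n
  define Y where "Y n = (\<lambda>\<omega>. s n * (X n \<omega> - c n))" for n
  have c: "\<sigma> * c n > t + real (Suc n)" for n using f by (simp add: c_def)
  have c_pos: "\<sigma> * c n > 0" for n using c[of n] t by simp
  have s: "0 < s n" "s n < 1" "s n \<le> t / real (Suc n)" for n
    using c[of n] c_pos[of n] t by (auto simp: s_def divide_simps)
  have s_lim: "(\<lambda>n. t / real (Suc n)) \<longlonglongrightarrow> 0"
    using tendsto_mult[OF tendsto_const[of t] LIMSEQ_inverse_real_of_nat] by (simp add: divide_inverse)
  \<comment> \<open>As \<open>\<sigma>\<close> squares to 1, the rescaled shift is the same for all
    \<open>n\<close>, and only the vanishing term \<open>s n * X n\<close> varies.\<close>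
  have sc: "s n * c n = t * \<sigma>" for n
    using c_pos[of n] \<sigma> by (auto simp: s_def)
  have X: "X n \<in> Lp M p" "Lp_norm M p (X n) \<le> ennreal K" for n
    using f by (auto simp: X_def)
  have Y_Lp: "Y n \<in> Lp M p" for n
    unfolding Y_def by (intro Lp_scale Lp_diff_const X)
  \<comment> \<open>\<open>Y n\<close> is a convex combination of 0 and \<open>X n - c n\<close>,
    and the error of 0 is 0.\<close>
  have E_Y: "E (Y n) \<le> ereal (t / real (Suc n) * a)" for n
  proof -
    have "E (\<lambda>\<omega>. (1 - s n) * 0 + s n * (X n \<omega> - c n))
        \<le> ereal (1 - s n) * E (\<lambda>_. 0) + ereal (s n) * E (\<lambda>\<omega>. X n \<omega> - c n)"
      using convex_functionalD[of E "\<lambda>_. 0" "\<lambda>\<omega>. X n \<omega> - c n" "s n"] E s[of n] Lp_diff_const[OF X(1)]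
      by simp
    also have "\<dots> = ereal (s n) * E (\<lambda>\<omega>. X n \<omega> - c n)"
      using E by simp
    also have "\<dots> \<le> ereal (s n) * ereal a"
      using f(3)[of n] s(1)[of n] by (intro ereal_mult_left_mono) (auto simp: X_def c_def)
    also have "\<dots> \<le> ereal (t / real (Suc n) * a)"
      using mult_right_mono[OF s(3)[of n] a] by (simp del: of_nat_Suc)
    finally show ?thesis by (simp add: Y_def)
  qed
  have "Lp_lim Y (\<lambda>_. t * - \<sigma>)"
    unfolding Lp_lim_def
  proof (intro conjI allI impI)
    fix \<epsilon> :: real assume e: "0 < \<epsilon>"
    have "(\<lambda>n. t / real (Suc n) * K) \<longlonglongrightarrow> 0"
      using tendsto_mult[OF s_lim tendsto_const[of K]] by simp
    then have "\<forall>\<^sub>F n in sequentially. t / real (Suc n) * K < \<epsilon>"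
      using e by (rule order_tendstoD)
    then show "\<forall>\<^sub>F n in sequentially. Lp_norm M p (\<lambda>\<omega>. Y n \<omega> - t * - \<sigma>) \<le> ennreal \<epsilon>"
    proof eventually_elim
      case (elim n)
      have "(\<lambda>\<omega>. Y n \<omega> - t * - \<sigma>) = (\<lambda>\<omega>. s n * X n \<omega>)"
        using sc[of n] by (auto simp: Y_def algebra_simps)
      moreover have "Lp_norm M p (\<lambda>\<omega>. s n * X n \<omega>) \<le> ennreal (\<bar>s n\<bar> * K)"
        using X K by (intro Lp_norm_scale_le) (auto simp: Lp_measurable)
      moreover have "\<bar>s n\<bar> * K \<le> \<epsilon>"
        using mult_right_mono[OF s(3)[of n] K] s(1)[of n] elim by simp
      ultimately show ?case by (auto intro: order_trans ennreal_leI)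
    qed
  qed (use Y_Lp in auto)
  then have "\<forall>\<^sub>F n in sequentially. ereal b < E (Y n)"
    using E b by (intro closed_functional_lsc) auto
  moreover have "(\<lambda>n. t / real (Suc n) * a) \<longlonglongrightarrow> 0"
    using tendsto_mult[OF s_lim tendsto_const[of a]] by simp
  then have "\<forall>\<^sub>F n in sequentially. t / real (Suc n) * a < b"
    using b(1) by (rule order_tendstoD)
  ultimately have "\<forall>\<^sub>F n in sequentially. False"
  proof eventually_elim
    case (elim n)
    have "ereal b < ereal (t / real (Suc n) * a)" using elim(1) E_Y[of n] by (rule less_le_trans)
    with elim(2) show ?case by simp
  qed
  then show False by simp
qed

text \<open>One bound \<open>B\<close> serves the whole norm ball, so it applies along a convergent
  sequence of random variables and not just to a single one.\<close>

lemma subregular_error_shift_bound: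
  assumes "subregular_error M p E" "0 \<le> K" "0 \<le> a"
  obtains B where "\<And>X c. X \<in> Lp M p \<Longrightarrow> Lp_norm M p X \<le> ennreal K \<Longrightarrow>
    E (\<lambda>\<omega>. X \<omega> - c) \<le> ereal a \<Longrightarrow> \<bar>c\<bar> \<le> B"
proof -
  obtain B1 where B1: "\<forall>X\<in>Lp M p. \<forall>c. Lp_norm M p X \<le> ennreal K \<longrightarrow>
      E (\<lambda>\<omega>. X \<omega> - c) \<le> ereal a \<longrightarrow> 1 * c \<le> B1"
    using subregular_error_shift_bound_aux[OF assms, of 1] by blast
  obtain B2 where B2: "\<forall>X\<in>Lp M p. \<forall>c. Lp_norm M p X \<le> ennreal K \<longrightarrow>
      E (\<lambda>\<omega>. X \<omega> - c) \<le> ereal a \<longrightarrow> - 1 * c \<le> B2"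
    using subregular_error_shift_bound_aux[OF assms, of "- 1"] by blast
  show ?thesis
  proof (rule that[of "max B1 B2"])
    fix X c assume "X \<in> Lp M p" "Lp_norm M p X \<le> ennreal K" "E (\<lambda>\<omega>. X \<omega> - c) \<le> ereal a"
    with B1 B2 have "1 * c \<le> B1" "- 1 * c \<le> B2" by blast+
    then show "\<bar>c\<bar> \<le> max B1 B2" by auto
  qed
qed

end


section \<open>Mixtures of quadrangles\<close>

locale risk_quadrangles = prob_Lp M p for M :: "'a measure" and p :: ennreal +
  fixes r :: nat and w :: "nat \<Rightarrow> real"
    and R D V E :: "nat \<Rightarrow> ('a \<Rightarrow> real) \<Rightarrow> ereal"
    and S :: "nat \<Rightarrow> ('a \<Rightarrow> real) \<Rightarrow> real set"
  assumes quadrangle: "k \<in> {1..r} \<Longrightarrow> subregular_quadrangle M p (R k) (D k) (V k) (E k) (S k)"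
    and w_pos: "k \<in> {1..r} \<Longrightarrow> 0 < w k"
    and w_sum: "(\<Sum>k=1..r. w k) = 1"
begin

section \<open>Facts inherited from the component quadrangles\<close>

lemma deviation: "k \<in> {1..r} \<Longrightarrow> subregular_deviation M p (D k)"
  and error: "k \<in> {1..r} \<Longrightarrow> subregular_error M p (E k)"
  using quadrangle unfolding subregular_quadrangle_def by blast+

lemma D_nonneg: "k \<in> {1..r} \<Longrightarrow> X \<in> Lp M p \<Longrightarrow> 0 \<le> D k X"
  using deviation unfolding subregular_deviation_def by blast

lemma E_nonneg: "k \<in> {1..r} \<Longrightarrow> X \<in> Lp M p \<Longrightarrow> 0 \<le> E k X"
  using error unfolding subregular_error_def by blast

lemma R_eq: "k \<in> {1..r} \<Longrightarrow> X \<in> Lp M p \<Longrightarrow> R k X = D k X + ereal (expectation X)"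
  using quadrangle unfolding subregular_quadrangle_def by blast

lemma V_eq: "k \<in> {1..r} \<Longrightarrow> X \<in> Lp M p \<Longrightarrow> V k X = E k X + ereal (expectation X)"
  using quadrangle unfolding subregular_quadrangle_def by blast

lemma D_min: "k \<in> {1..r} \<Longrightarrow> X \<in> Lp M p \<Longrightarrow> is_min_of (D k X) (\<lambda>C. E k (\<lambda>\<omega>. X \<omega> - C)) (\<lambda>_. True)"
  using quadrangle unfolding subregular_quadrangle_def by blast

lemma D_le_E: "k \<in> {1..r} \<Longrightarrow> X \<in> Lp M p \<Longrightarrow> D k X \<le> E k (\<lambda>\<omega>. X \<omega> - C)"
  by (drule (1) D_min, erule is_min_ofE) auto

text \<open>The minimum is attained, so the minimizers form a level set; when \<open>D k X\<close>
  is infinite, that set is the whole line.\<close>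

lemma S_eq: "k \<in> {1..r} \<Longrightarrow> X \<in> Lp M p \<Longrightarrow> S k X = {C. E k (\<lambda>\<omega>. X \<omega> - C) = D k X}"
  using quadrangle argmin_set_eq[OF D_min] unfolding subregular_quadrangle_def by blast

lemma S_nonempty: "k \<in> {1..r} \<Longrightarrow> X \<in> Lp M p \<Longrightarrow> S k X \<noteq> {}"
  unfolding S_eq by (drule (1) D_min, erule is_min_ofE) auto

lemma shifted_sum_nonneg: "X \<in> Lp M p \<Longrightarrow> 0 \<le> shifted_sum r w E X c"
  unfolding shifted_sum_def
  by (intro sum_nonneg ereal_0_le_mult) (auto simp: less_imp_le w_pos E_nonneg Lp_diff_const)

lemma mix_inf_nonneg: "X \<in> Lp M p \<Longrightarrow> 0 \<le> mix_inf r w E X"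
  unfolding mix_inf_def by (intro INF_greatest shifted_sum_nonneg)

lemma balanced_zero: "balanced r w (\<lambda>_. 0)"
  by (simp add: balanced_def)

lemma mix_inf_le: "balanced r w c \<Longrightarrow> mix_inf r w F X \<le> shifted_sum r w F X c"
  unfolding mix_inf_def by (rule INF_lower) simp

lemma weighted_E_le_shifted_sum:
  assumes X: "X \<in> Lp M p" and k: "k \<in> {1..r}"
  shows "ereal (w k) * E k (\<lambda>\<omega>. X \<omega> - c k) \<le> shifted_sum r w E X c"
  unfolding shifted_sum_def
  using k X
  by (intro nonneg_ereal_le_sum[of _ k "\<lambda>k. ereal (w k) * E k (\<lambda>\<omega>. X \<omega> - c k)"])
    (auto intro!: ereal_0_le_mult E_nonneg Lp_diff_const less_imp_le[OF w_pos])

text \<open>All terms are nonnegative, so a bound on the sum bounds each one, up to division by its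
  weight.\<close>

lemma E_le_of_shifted_sum_le:
  assumes X: "X \<in> Lp M p" and k: "k \<in> {1..r}" and le: "shifted_sum r w E X c \<le> ereal a"
  shows "E k (\<lambda>\<omega>. X \<omega> - c k) \<le> ereal (a / w k)"
proof -
  have "ereal (w k) * E k (\<lambda>\<omega>. X \<omega> - c k) \<le> ereal a"
    using weighted_E_le_shifted_sum[OF X k] le by (rule order_trans)
  then show ?thesis
    using w_pos[OF k] by (cases "E k (\<lambda>\<omega>. X \<omega> - c k)") (auto simp: field_simps)
qed

section \<open>Compactness of balanced shifts and attainment of the minimum\<close>

text \<open>Bounded sums bound each error, coercivity bounds the shifts, and a subsequence of the
  tuples converges; balance passes to the limit by continuity, the bound on the sum by lower
  semicontinuity. A constant sequence \<open>X\<close> yields attainment, a constant bound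
  \<open>a\<close> yields closedness.\<close>

lemma shifted_sum_limit:
  assumes X: "Lp_lim X x" and c: "\<And>n. balanced r w (c n)"
    and le: "\<And>n. shifted_sum r w E (X n) (c n) \<le> ereal (a n)" and a: "a \<longlonglongrightarrow> b"
  shows "\<exists>d. balanced r w d \<and> shifted_sum r w E x d \<le> ereal b"
proof -
  have XLp: "\<And>n. X n \<in> Lp M p" "x \<in> Lp M p" using X by (auto simp: Lp_lim_def)
  obtain A where A: "0 < A" "\<And>n. \<bar>a n\<bar> \<le> A"
    using Bseq_def[of a] convergent_imp_Bseq[of a] a by (auto simp: convergent_def)
  obtain K where K: "0 < K" "Lp_norm M p x \<le> ennreal K" using XLp(2) by (rule Lp_normE)
  \<comment> \<open>Only from some \<open>N\<close> on are the \<open>X n\<close> within distance 1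
    of \<open>x\<close>, so the tuples are indexed by \<open>N + n\<close>; this gives the common
    norm bound \<open>4 * (1 + K)\<close>.\<close>
  obtain N where N: "\<And>n. N \<le> n \<Longrightarrow> Lp_norm M p (\<lambda>\<omega>. X n \<omega> - x \<omega>) \<le> ennreal 1"
    using X unfolding Lp_lim_def eventually_sequentially by (meson zero_less_one)
  have norm_X: "Lp_norm M p (X n) \<le> ennreal (4 * (1 + K))" if "N \<le> n" for n
  proof -
    have [measurable]: "X n \<in> borel_measurable M" "x \<in> borel_measurable M"
      using XLp Lp_measurable by auto
    have "Lp_norm M p (\<lambda>\<omega>. (X n \<omega> - x \<omega>) + x \<omega>) \<le> ennreal (4 * (1 + K))"
      using K N[OF that] by (intro Lp_norm_add_le) auto
    then show ?thesis by simp
  qed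
  have "bounded (range (\<lambda>n. c (N + n) k))" if k: "k \<in> {1..r}" for k
  proof -
    obtain B where B: "\<And>Y d. Y \<in> Lp M p \<Longrightarrow> Lp_norm M p Y \<le> ennreal (4 * (1 + K)) \<Longrightarrow>
        E k (\<lambda>\<omega>. Y \<omega> - d) \<le> ereal (A / w k) \<Longrightarrow> \<bar>d\<bar> \<le> B"
      by (rule subregular_error_shift_bound[OF error[OF k], of "4 * (1 + K)" "A / w k"])
        (use K A w_pos[OF k] in \<open>auto simp: less_imp_le\<close>)
    have "\<bar>c (N + n) k\<bar> \<le> B" for n
    proof (rule B)
      have "shifted_sum r w E (X (N + n)) (c (N + n)) \<le> ereal A"
        using le[of "N + n"] A(2)[of "N + n"] by (auto intro: order_trans)
      then show "E k (\<lambda>\<omega>. X (N + n) \<omega> - c (N + n) k) \<le> ereal (A / w k)"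
        by (rule E_le_of_shifted_sum_le[OF XLp(1) k])
    qed (use XLp norm_X in auto)
    then show ?thesis by (auto simp: bounded_iff)
  qed
  then obtain s0 where s0: "strict_mono s0" "\<forall>k\<in>{1..r}. convergent (\<lambda>n. c (N + s0 n) k)"
    using finite_bounded_convergent_subseq[of "{1..r}" "\<lambda>n. c (N + n)"] by auto
  define s where "s n = N + s0 n" for n
  define d where "d k = lim (\<lambda>n. c (s n) k)" for k
  have s: "strict_mono s" using s0(1) by (auto simp: s_def strict_mono_def)
  have d: "(\<lambda>n. c (s n) k) \<longlonglongrightarrow> d k" if "k \<in> {1..r}" for k
    using s0(2) that by (simp add: d_def s_def convergent_LIMSEQ_iff)
  have "(\<lambda>n. \<Sum>k=1..r. w k * c (s n) k) \<longlonglongrightarrow> (\<Sum>k=1..r. w k * d k)"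
    by (intro tendsto_sum tendsto_mult_left d)
  then have "balanced r w d"
    using c by (simp add: balanced_def LIMSEQ_const_iff)
  moreover have "shifted_sum r w E x d \<le> ereal b"
    unfolding shifted_sum_def
  proof (rule weighted_sum_le_lim)
    fix k y assume k: "k \<in> {1..r}" and y: "y < E k (\<lambda>\<omega>. x \<omega> - d k)"
    have "Lp_lim (\<lambda>n \<omega>. (X \<circ> s) n \<omega> - c (s n) k) (\<lambda>\<omega>. x \<omega> - d k)"
      by (intro Lp_lim_diff_const Lp_lim_subseq X s d k)
    then show "\<forall>\<^sub>F n in sequentially. y < E k (\<lambda>\<omega>. (X \<circ> s) n \<omega> - c (s n) k)"
      using error[OF k] y unfolding subregular_error_def by (intro closed_functional_lsc) auto
  next
    show "(\<Sum>k=1..r. ereal (w k) * E k (\<lambda>\<omega>. (X \<circ> s) n \<omega> - c (s n) k)) \<le> ereal ((a \<circ> s) n)" for n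
      using le[of "s n"] by (simp add: shifted_sum_def)
    show "(a \<circ> s) \<longlonglongrightarrow> b" using a s by (rule LIMSEQ_subseq_LIMSEQ)
  qed (use XLp in \<open>auto simp: w_pos less_imp_le intro!: E_nonneg Lp_diff_const\<close>)
  ultimately show ?thesis by blast
qed

text \<open>A minimizing sequence of tuples at the fixed \<open>X\<close> yields an optimal tuple by
  \<open>shifted_sum_limit\<close>. An infinite infimum is attained by every balanced tuple, and the
  zero tuple is taken.\<close>

lemma mix_inf_attained:
  assumes X: "X \<in> Lp M p"
  obtains c where "balanced r w c" "mix_inf r w E X = shifted_sum r w E X c"
proof (cases "mix_inf r w E X")
  case (real m)
  have "\<exists>c. balanced r w c \<and> shifted_sum r w E X c \<le> ereal (m + inverse (real (Suc n)))" for n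
  proof -
    have "mix_inf r w E X < ereal (m + inverse (real (Suc n)))"
      using real by (simp del: of_nat_Suc)
    then show ?thesis
      unfolding mix_inf_def INF_less_iff by (auto intro: less_imp_le)
  qed
  then obtain c where c: "\<And>n. balanced r w (c n)"
      "\<And>n. shifted_sum r w E X (c n) \<le> ereal (m + inverse (real (Suc n)))"
    by metis
  have "(\<lambda>n. m + inverse (real (Suc n))) \<longlonglongrightarrow> m"
    using tendsto_add[OF tendsto_const[of m] LIMSEQ_inverse_real_of_nat] by simp
  from shifted_sum_limit[OF Lp_lim_const[OF X] c this] obtain d
    where "balanced r w d" "shifted_sum r w E X d \<le> ereal m" by blast
  with real mix_inf_le[of d E X] show ?thesis
    by (intro that[of d]) (auto intro: antisym)
next
  case PInf
  with mix_inf_le[OF balanced_zero, of E X] show ?thesis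
    by (intro that[OF balanced_zero]) auto
next
  case MInf
  with mix_inf_nonneg[OF X] show ?thesis by simp
qed

lemma mix_inf_E_min: "X \<in> Lp M p \<Longrightarrow> is_min_of (mix_inf r w E X) (shifted_sum r w E X) (balanced r w)"
  by (erule mix_inf_attained, rule is_min_ofI) (auto dest: mix_inf_le[where F = E and X = X])

section \<open>From errors to regrets and from deviations to risks\<close>

text \<open>The weights sum to 1 and the weighted shifts to 0, so the expectations of the variables
  \<open>X - c k\<close> average to that of \<open>X\<close>.\<close>

lemma shifted_sum_V:
  assumes X: "X \<in> Lp M p" and c: "balanced r w c"
  shows "shifted_sum r w V X c = shifted_sum r w E X c + ereal (expectation X)"
proof -
  have "shifted_sum r w V X c =
      (\<Sum>k=1..r. ereal (w k) * E k (\<lambda>\<omega>. X \<omega> - c k) + ereal (w k * (expectation X - c k)))"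
    unfolding shifted_sum_def
  proof (rule sum.cong)
    fix k assume k: "k \<in> {1..r}"
    have "V k (\<lambda>\<omega>. X \<omega> - c k) = E k (\<lambda>\<omega>. X \<omega> - c k) + ereal (expectation X - c k)"
      using V_eq[OF k Lp_diff_const[OF X]] by (simp add: expectation_diff_const[OF X])
    then show "ereal (w k) * V k (\<lambda>\<omega>. X \<omega> - c k) =
        ereal (w k) * E k (\<lambda>\<omega>. X \<omega> - c k) + ereal (w k * (expectation X - c k))"
      by (simp add: ereal_distrib_left)
  qed simp
  also have "\<dots> = shifted_sum r w E X c + ereal (\<Sum>k=1..r. w k * (expectation X - c k))"
    by (simp add: shifted_sum_def sum.distrib)
  also have "(\<Sum>k=1..r. w k * (expectation X - c k)) = expectation X"
    using c w_sum by (simp add: balanced_def right_diff_distrib sum_subtractf flip: sum_distrib_right)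
  finally show ?thesis .
qed

lemma mix_inf_V:
  assumes X: "X \<in> Lp M p"
  shows "mix_inf r w V X = mix_inf r w E X + ereal (expectation X)"
proof (rule antisym)
  obtain c where c: "balanced r w c" "mix_inf r w E X = shifted_sum r w E X c"
    using mix_inf_attained[OF X] .
  then show "mix_inf r w V X \<le> mix_inf r w E X + ereal (expectation X)"
    using mix_inf_le[OF c(1), of V X] by (simp add: shifted_sum_V[OF X])
  show "mix_inf r w E X + ereal (expectation X) \<le> mix_inf r w V X"
    unfolding mix_inf_def[of r w V]
    using mix_inf_le[of _ E X] by (intro INF_greatest) (auto simp: shifted_sum_V[OF X] add_mono)
qed

lemma mix_inf_V_min: "X \<in> Lp M p \<Longrightarrow> is_min_of (mix_inf r w V X) (shifted_sum r w V X) (balanced r w)"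
  by (rule is_min_of_add[OF mix_inf_E_min]) (auto simp: shifted_sum_V mix_inf_V)

lemma mix_sum_R:
  assumes X: "X \<in> Lp M p"
  shows "mix_sum r w R X = mix_sum r w D X + ereal (expectation X)"
proof -
  have "mix_sum r w R X = (\<Sum>k=1..r. ereal (w k) * D k X + ereal (w k * expectation X))"
    unfolding mix_sum_def by (rule sum.cong) (auto simp: R_eq X ereal_distrib_left)
  then show ?thesis
    using w_sum by (simp add: mix_sum_def sum.distrib flip: sum_distrib_right)
qed

lemma mix_sum_nonneg: "X \<in> Lp M p \<Longrightarrow> 0 \<le> mix_sum r w D X"
  unfolding mix_sum_def by (intro sum_nonneg ereal_0_le_mult) (auto simp: less_imp_le w_pos D_nonneg)

section \<open>Decoupling of the shifts and the mixed statistic\<close>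

text \<open>The shifts \<open>C\<close> and \<open>c k\<close> combine to \<open>C + c k\<close>,
  and each term is bounded below by its own minimum \<open>D k X\<close>.\<close>

lemma mix_sum_le_mix_inf:
  assumes X: "X \<in> Lp M p"
  shows "mix_sum r w D X \<le> mix_inf r w E (\<lambda>\<omega>. X \<omega> - C)"
  unfolding mix_inf_def
proof (rule INF_greatest)
  fix c
  show "mix_sum r w D X \<le> shifted_sum r w E (\<lambda>\<omega>. X \<omega> - C) c"
    unfolding mix_sum_def shifted_sum_def diff_diff_eq
    using X w_pos by (intro sum_mono ereal_mult_left_mono D_le_E) (auto simp: less_imp_le)
qed

lemma mem_mix_statistic_iff:
  "C \<in> mix_statistic r w S X \<longleftrightarrow> (\<exists>c. (\<forall>k\<in>{1..r}. c k \<in> S k X) \<and> C = (\<Sum>k=1..r. w k * c k))"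
proof
  assume "C \<in> mix_statistic r w S X"
  then obtain s where s: "C = sum s {1..r}" "\<forall>k\<in>{1..r}. s k \<in> (\<lambda>c. w k * c) ` S k X"
    unfolding mix_statistic_def set_sum_alt[OF finite_atLeastAtMost] by blast
  then have "\<forall>k\<in>{1..r}. \<exists>c. c \<in> S k X \<and> s k = w k * c" by blast
  then obtain c where "\<forall>k\<in>{1..r}. c k \<in> S k X \<and> s k = w k * c k" by metis
  with s show "\<exists>c. (\<forall>k\<in>{1..r}. c k \<in> S k X) \<and> C = (\<Sum>k=1..r. w k * c k)"
    by (auto intro!: exI[of _ c])
next
  assume "\<exists>c. (\<forall>k\<in>{1..r}. c k \<in> S k X) \<and> C = (\<Sum>k=1..r. w k * c k)"
  then show "C \<in> mix_statistic r w S X"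
    unfolding mix_statistic_def set_sum_alt[OF finite_atLeastAtMost] by blast
qed

text \<open>Balanced tuples \<open>c\<close> for \<open>X - C\<close> correspond to tuples
  \<open>C + c k\<close> of weighted mean \<open>C\<close>. If all \<open>D k X\<close> are finite,
  the lower bound is met exactly when each \<open>C + c k\<close> is a minimizer for its component;
  infinite values need a separate case.\<close>

lemma mix_inf_eq_mix_sum_iff:
  assumes X: "X \<in> Lp M p"
  shows "mix_inf r w E (\<lambda>\<omega>. X \<omega> - C) = mix_sum r w D X \<longleftrightarrow> C \<in> mix_statistic r w S X"
proof
  assume "C \<in> mix_statistic r w S X"
  then obtain c where c: "\<And>k. k \<in> {1..r} \<Longrightarrow> c k \<in> S k X" "C = (\<Sum>k=1..r. w k * c k)"
    unfolding mem_mix_statistic_iff by blast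
  \<comment> \<open>As \<open>C\<close> is the weighted mean of the \<open>c k\<close>, the
    differences are balanced, and shifting \<open>X - C\<close> by them gives the shifts
    \<open>c k\<close> of \<open>X\<close>.\<close>
  have "balanced r w (\<lambda>k. c k - C)"
    using w_sum c(2)
    by (simp add: balanced_def right_diff_distrib sum_subtractf flip: sum_distrib_right)
  then have "mix_inf r w E (\<lambda>\<omega>. X \<omega> - C) \<le> shifted_sum r w E (\<lambda>\<omega>. X \<omega> - C) (\<lambda>k. c k - C)"
    by (rule mix_inf_le)
  also have "\<dots> = mix_sum r w D X"
    unfolding shifted_sum_def mix_sum_def using c(1) X
    by (intro sum.cong) (auto simp: S_eq)
  finally show "mix_inf r w E (\<lambda>\<omega>. X \<omega> - C) = mix_sum r w D X"
    using mix_sum_le_mix_inf[OF X] by (rule antisym)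
next
  assume eq: "mix_inf r w E (\<lambda>\<omega>. X \<omega> - C) = mix_sum r w D X"
  show "C \<in> mix_statistic r w S X"
  proof (cases "\<exists>k\<in>{1..r}. D k X = \<infinity>")
    case True
    then obtain j where j: "j \<in> {1..r}" "D j X = \<infinity>" by blast
    \<comment> \<open>An infinite \<open>D j X\<close> leaves \<open>S j X\<close> unrestricted, so
      the other coordinates may be arbitrary members of their statistics, and coordinate
      \<open>j\<close> is solved for to reach \<open>C\<close>.\<close>
    then have Sj: "S j X = UNIV"
      using D_le_E[OF j(1) X] by (auto simp: S_eq X)
    define s where "s k = (SOME c. c \<in> S k X)" for k
    have s: "s k \<in> S k X" if "k \<in> {1..r}" for k
      using S_nonempty[OF that X] by (auto simp: s_def some_in_eq)
    define c where "c = s(j := (C - (\<Sum>k\<in>{1..r} - {j}. w k * s k)) / w j)"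
    have "(\<Sum>k=1..r. w k * c k) = w j * c j + (\<Sum>k\<in>{1..r} - {j}. w k * s k)"
      using j by (subst sum.remove[of _ j]) (auto simp: c_def intro!: sum.cong)
    also have "\<dots> = C"
      using w_pos[OF j(1)] by (simp add: c_def)
    finally show ?thesis
      unfolding mem_mix_statistic_iff using s Sj by (intro exI[of _ c]) (auto simp: c_def)
  next
    case fin: False
    obtain c where c: "balanced r w c"
        "mix_inf r w E (\<lambda>\<omega>. X \<omega> - C) = shifted_sum r w E (\<lambda>\<omega>. X \<omega> - C) c"
      using mix_inf_attained[OF Lp_diff_const[OF X]] .
    \<comment> \<open>Equality of the sums forces equality term by term, because all
      \<open>D k X\<close> are finite here.\<close>
    have "D k X = E k (\<lambda>\<omega>. X \<omega> - (C + c k))" if "k \<in> {1..r}" for k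
    proof (rule weighted_sum_eq_imp_eq[of "{1..r}" w "\<lambda>k. D k X" "\<lambda>k. E k (\<lambda>\<omega>. X \<omega> - (C + c k))"])
      show "(\<Sum>k=1..r. ereal (w k) * D k X) = (\<Sum>k=1..r. ereal (w k) * E k (\<lambda>\<omega>. X \<omega> - (C + c k)))"
        using eq c(2) by (simp add: mix_sum_def shifted_sum_def diff_diff_eq)
    qed (use that fin X in \<open>auto simp: w_pos D_nonneg D_le_E\<close>)
    then have "C + c k \<in> S k X" if "k \<in> {1..r}" for k
      using that by (simp add: S_eq X)
    moreover have "C = (\<Sum>k=1..r. w k * (C + c k))"
      using c(1) w_sum by (simp add: balanced_def distrib_left sum.distrib flip: sum_distrib_right)
    ultimately show ?thesis
      unfolding mem_mix_statistic_iff by (intro exI[of _ "\<lambda>k. C + c k"]) blast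
  qed
qed

lemma mix_statistic_nonempty:
  assumes X: "X \<in> Lp M p"
  shows "mix_statistic r w S X \<noteq> {}"
proof -
  have "\<exists>c. \<forall>k\<in>{1..r}. c k \<in> S k X"
    using S_nonempty[OF _ X] by (intro bchoice) blast
  then show ?thesis using mem_mix_statistic_iff by blast
qed

lemma mix_sum_min:
  assumes X: "X \<in> Lp M p"
  shows "is_min_of (mix_sum r w D X) (\<lambda>C. mix_inf r w E (\<lambda>\<omega>. X \<omega> - C)) (\<lambda>_. True)"
proof -
  obtain C where "C \<in> mix_statistic r w S X" using mix_statistic_nonempty[OF X] by blast
  then have "mix_inf r w E (\<lambda>\<omega>. X \<omega> - C) = mix_sum r w D X"
    by (simp add: mix_inf_eq_mix_sum_iff X)
  with mix_sum_le_mix_inf[OF X] show ?thesis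
    by (intro is_min_ofI[of _ C]) auto
qed

section \<open>Subregularity of the mixed deviation and the mixed error\<close>

lemma index_set_nonempty: "{1..r} \<noteq> {}"
  using w_sum by (metis sum.empty zero_neq_one)

lemma deviation_mix_sum: "subregular_deviation M p (mix_sum r w D)"
proof -
  have dev: "Lp_functional M p (D k)" "closed_functional M p (D k)" "convex_functional M p (D k)"
    "\<And>C. D k (\<lambda>_. C) = 0"
    "\<And>X. X \<in> Lp M p \<Longrightarrow> \<not> ae_constant M X \<Longrightarrow> \<exists>t>0. D k (\<lambda>\<omega>. t * X \<omega>) > 0"
    if "k \<in> {1..r}" for k
    using deviation[OF that] unfolding subregular_deviation_def by blast+
  have "Lp_functional M p (mix_sum r w D)"
    unfolding Lp_functional_def
  proof (intro conjI ballI impI)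
    fix X assume "X \<in> Lp M p"
    from mix_sum_nonneg[OF this] show "mix_sum r w D X \<noteq> -\<infinity>" by auto
  next
    fix X Y assume XY: "X \<in> Lp M p" "Y \<in> Lp M p" "AE \<omega> in M. X \<omega> = Y \<omega>"
    have "D k X = D k Y" if "k \<in> {1..r}" for k
      using dev(1)[OF that] XY by (rule Lp_functional_cong)
    then show "mix_sum r w D X = mix_sum r w D Y"
      by (simp add: mix_sum_def)
  qed
  moreover have "closed_functional M p (mix_sum r w D)"
  proof (rule closed_functionalI)
    fix X x C assume X: "Lp_lim X x" and le: "\<And>n. mix_sum r w D (X n) \<le> ereal C"
    show "mix_sum r w D x \<le> ereal C"
      unfolding mix_sum_def
    proof (rule weighted_sum_le_lim)
      show "(\<Sum>k=1..r. ereal (w k) * D k (X n)) \<le> ereal C" for n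
        using le by (simp add: mix_sum_def)
      show "\<forall>\<^sub>F n in sequentially. y < D k (X n)" if "k \<in> {1..r}" "y < D k x" for k y
        using dev(2)[OF that(1)] X that(2) by (rule closed_functional_lsc)
    qed (use X in \<open>auto simp: Lp_lim_def w_pos less_imp_le D_nonneg\<close>)
  qed
  moreover have "convex_functional M p (mix_sum r w D)"
    unfolding convex_functional_def mix_sum_def
    by (intro ballI allI impI weighted_sum_convex_le convex_functionalD dev(3))
      (auto simp: w_pos less_imp_le D_nonneg)
  moreover have "mix_sum r w D (\<lambda>_. C) = 0" for C
    by (simp add: mix_sum_def dev(4))
  moreover have "\<exists>t>0. mix_sum r w D (\<lambda>\<omega>. t * X \<omega>) > 0" if X: "X \<in> Lp M p" "\<not> ae_constant M X" for X
  proof -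
    \<comment> \<open>One component with positive deviation suffices, as the other terms are
      nonnegative.\<close>
    obtain j where j: "j \<in> {1..r}" using index_set_nonempty by blast
    obtain t where t: "t > 0" "D j (\<lambda>\<omega>. t * X \<omega>) > 0" using dev(5)[OF j X] by blast
    have "0 < ereal (w j) * D j (\<lambda>\<omega>. t * X \<omega>)"
      using t w_pos[OF j] by (simp add: ereal_zero_less_0_iff)
    also have "\<dots> \<le> mix_sum r w D (\<lambda>\<omega>. t * X \<omega>)"
      unfolding mix_sum_def
      using j X
      by (intro nonneg_ereal_le_sum[of _ j "\<lambda>k. ereal (w k) * D k (\<lambda>\<omega>. t * X \<omega>)"])
        (auto intro!: ereal_0_le_mult D_nonneg Lp_scale less_imp_le[OF w_pos])
    finally show ?thesis using t(1) by blast
  qed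
  ultimately show ?thesis
    unfolding subregular_deviation_def using mix_sum_nonneg by blast
qed

text \<open>Convexity and closedness rest on attained minima: optimal tuples can be combined or
  passed to a limit. For positivity, a nonconstant variable is detected by the mixed deviation,
  while an almost surely constant one needs coercivity.\<close>

lemma error_mix_inf: "subregular_error M p (mix_inf r w E)"
proof -
  have err: "Lp_functional M p (E k)" "convex_functional M p (E k)" "E k (\<lambda>_. 0) = 0"
    if "k \<in> {1..r}" for k
    using error[OF that] unfolding subregular_error_def by blast+
  have "Lp_functional M p (mix_inf r w E)"
    unfolding Lp_functional_def
  proof (intro conjI ballI impI)
    fix X assume "X \<in> Lp M p"
    from mix_inf_nonneg[OF this] show "mix_inf r w E X \<noteq> -\<infinity>" by auto
  next
    fix X Y assume XY: "X \<in> Lp M p" "Y \<in> Lp M p" "AE \<omega> in M. X \<omega> = Y \<omega>"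
    have "E k (\<lambda>\<omega>. X \<omega> - c) = E k (\<lambda>\<omega>. Y \<omega> - c)" if "k \<in> {1..r}" for k c
    proof -
      have "AE \<omega> in M. X \<omega> - c = Y \<omega> - c" using XY(3) by eventually_elim simp
      then show ?thesis
        by (rule Lp_functional_cong[OF err(1)[OF that] Lp_diff_const[OF XY(1)] Lp_diff_const[OF XY(2)]])
    qed
    then show "mix_inf r w E X = mix_inf r w E Y"
      by (simp add: mix_inf_def shifted_sum_def)
  qed
  moreover have "closed_functional M p (mix_inf r w E)"
  proof (rule closed_functionalI)
    fix X x C assume X: "Lp_lim X x" and le: "\<And>n. mix_inf r w E (X n) \<le> ereal C"
    have "\<exists>c. balanced r w c \<and> shifted_sum r w E (X n) c \<le> ereal C" for n
    proof -
      have "X n \<in> Lp M p" using X by (simp add: Lp_lim_def)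
      then obtain c where "balanced r w c" "mix_inf r w E (X n) = shifted_sum r w E (X n) c"
        by (rule mix_inf_attained)
      with le[of n] show ?thesis by auto
    qed
    then obtain c where c: "\<And>n. balanced r w (c n)" "\<And>n. shifted_sum r w E (X n) (c n) \<le> ereal C"
      by metis
    from shifted_sum_limit[OF X c tendsto_const] show "mix_inf r w E x \<le> ereal C"
      using mix_inf_le by (blast intro: order_trans)
  qed
  moreover have "convex_functional M p (mix_inf r w E)"
    unfolding convex_functional_def
  proof (intro ballI allI impI)
    fix X Y t assume XY: "X \<in> Lp M p" "Y \<in> Lp M p" and t: "0 < t \<and> t < (1::real)"
    obtain c where c: "balanced r w c" "mix_inf r w E X = shifted_sum r w E X c"
      using mix_inf_attained[OF XY(1)] .
    obtain d where d: "balanced r w d" "mix_inf r w E Y = shifted_sum r w E Y d"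
      using mix_inf_attained[OF XY(2)] .
    \<comment> \<open>Balanced tuples form a linear space, so the combination of optimal shifts is
      admissible for the combination of \<open>X\<close> and \<open>Y\<close>.\<close>
    let ?e = "\<lambda>k. (1 - t) * c k + t * d k"
    have "(\<Sum>k=1..r. w k * ?e k) = (1 - t) * (\<Sum>k=1..r. w k * c k) + t * (\<Sum>k=1..r. w k * d k)"
      by (simp add: distrib_left sum.distrib sum_distrib_left mult.left_commute)
    then have e: "balanced r w ?e" using c d by (simp add: balanced_def)
    have "shifted_sum r w E (\<lambda>\<omega>. (1 - t) * X \<omega> + t * Y \<omega>) ?e
        \<le> ereal (1 - t) * shifted_sum r w E X c + ereal t * shifted_sum r w E Y d"
      unfolding shifted_sum_def
    proof (rule weighted_sum_convex_le)
      fix k assume k: "k \<in> {1..r}"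
      have "(\<lambda>\<omega>. (1 - t) * X \<omega> + t * Y \<omega> - ?e k) =
          (\<lambda>\<omega>. (1 - t) * (X \<omega> - c k) + t * (Y \<omega> - d k))"
        by (simp add: algebra_simps)
      then show "E k (\<lambda>\<omega>. (1 - t) * X \<omega> + t * Y \<omega> - ?e k) \<le>
          ereal (1 - t) * E k (\<lambda>\<omega>. X \<omega> - c k) + ereal t * E k (\<lambda>\<omega>. Y \<omega> - d k)"
        using convex_functionalD[OF err(2)[OF k] Lp_diff_const[OF XY(1)] Lp_diff_const[OF XY(2)], of t "c k" "d k"] t
        by simp
    qed (use XY t in \<open>auto simp: w_pos less_imp_le E_nonneg Lp_diff_const\<close>)
    with mix_inf_le[OF e] show "mix_inf r w E (\<lambda>\<omega>. (1 - t) * X \<omega> + t * Y \<omega>)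
        \<le> ereal (1 - t) * mix_inf r w E X + ereal t * mix_inf r w E Y"
      unfolding c(2) d(2) by (rule order_trans)
  qed
  moreover have "mix_inf r w E (\<lambda>_. 0) = 0"
    using mix_inf_le[OF balanced_zero, of E "\<lambda>_. 0"] mix_inf_nonneg[of "\<lambda>_. 0"]
    by (simp add: shifted_sum_def err(3))
  moreover have "\<exists>t>0. mix_inf r w E (\<lambda>\<omega>. t * X \<omega>) > 0" if X: "X \<in> Lp M p" "\<not> ae_zero M X" for X
  proof (cases "ae_constant M X")
    case False
    then obtain t where t: "t > 0" "mix_sum r w D (\<lambda>\<omega>. t * X \<omega>) > 0"
      using deviation_mix_sum X unfolding subregular_deviation_def by blast
    then show ?thesis
      using mix_sum_le_mix_inf[OF Lp_scale[OF X(1), of t], of 0] by (auto intro: less_le_trans)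
  next
    case True
    then obtain C where C: "AE \<omega> in M. X \<omega> = C" unfolding ae_constant_def by blast
    with X(2) have "C \<noteq> 0" by (auto simp: ae_zero_def)
    \<comment> \<open>Coercivity with both bounds equal to 0: the constants at which
      \<open>E k\<close> vanishes form a bounded set.\<close>
    have "\<exists>B. \<forall>d. E k (\<lambda>\<omega>. - d) \<le> 0 \<longrightarrow> \<bar>d\<bar> \<le> B" if k: "k \<in> {1..r}" for k
    proof -
      obtain B where "\<And>X c. X \<in> Lp M p \<Longrightarrow> Lp_norm M p X \<le> ennreal 0 \<Longrightarrow>
          E k (\<lambda>\<omega>. X \<omega> - c) \<le> ereal 0 \<Longrightarrow> \<bar>c\<bar> \<le> B"
        by (rule subregular_error_shift_bound[OF error[OF k], of 0 0]) auto
      from this[of "\<lambda>_. 0"] Lp_norm_const_le[of 0] show ?thesis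
        by (auto simp: zero_ereal_def)
    qed
    then obtain B where B: "\<And>k d. k \<in> {1..r} \<Longrightarrow> E k (\<lambda>\<omega>. - d) \<le> 0 \<Longrightarrow> \<bar>d\<bar> \<le> B k"
      by metis
    define b where "b = (\<Sum>k=1..r. w k * B k)"
    \<comment> \<open>This choice makes \<open>\<bar>t * C\<bar>\<close> exceed \<open>b\<close> by
      at least 1.\<close>
    define t where "t = (\<bar>b\<bar> + 1) / \<bar>C\<bar>"
    have t: "0 < t" using \<open>C \<noteq> 0\<close> by (auto simp: t_def)
    have tX: "(\<lambda>\<omega>. t * X \<omega>) \<in> Lp M p" using X by (intro Lp_scale)
    have "\<not> mix_inf r w E (\<lambda>\<omega>. t * X \<omega>) \<le> 0"
    proof
      assume le: "mix_inf r w E (\<lambda>\<omega>. t * X \<omega>) \<le> 0"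
      obtain c where c: "balanced r w c"
          "mix_inf r w E (\<lambda>\<omega>. t * X \<omega>) = shifted_sum r w E (\<lambda>\<omega>. t * X \<omega>) c"
        using mix_inf_attained[OF tX] .
      \<comment> \<open>A nonpositive minimum makes every \<open>E k\<close> nonpositive at the
        constant \<open>- (c k - t * C)\<close>. By balance the weighted mean of the
        \<open>c k - t * C\<close> is \<open>- (t * C)\<close>, which is then at most
        \<open>b\<close> in absolute value.\<close>
      have "\<bar>c k - t * C\<bar> \<le> B k" if k: "k \<in> {1..r}" for k
      proof (rule B[OF k])
        have "AE \<omega> in M. t * X \<omega> - c k = - (c k - t * C)"
          using C by eventually_elim simp
        then have "E k (\<lambda>_. - (c k - t * C)) = E k (\<lambda>\<omega>. t * X \<omega> - c k)"
          by (rule Lp_functional_cong[OF err(1)[OF k] Lp_diff_const[OF tX] Lp_const, symmetric])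
        also have "\<dots> \<le> 0"
          using E_le_of_shifted_sum_le[OF tX k, of c 0] le c by (simp add: zero_ereal_def)
        finally show "E k (\<lambda>_. - (c k - t * C)) \<le> 0" .
      qed
      then have "(\<Sum>k=1..r. \<bar>w k * (c k - t * C)\<bar>) \<le> b"
        unfolding b_def using w_pos by (intro sum_mono) (simp add: abs_mult less_imp_le mult_left_mono)
      then have "\<bar>\<Sum>k=1..r. w k * (c k - t * C)\<bar> \<le> b"
        using sum_abs by (rule order_trans[rotated])
      moreover have "(\<Sum>k=1..r. w k * (c k - t * C)) = - (t * C)"
        using c(1) w_sum by (simp add: balanced_def right_diff_distrib sum_subtractf flip: sum_distrib_right)
      ultimately have "\<bar>t * C\<bar> \<le> b" by simp
      moreover have "\<bar>t * C\<bar> = \<bar>b\<bar> + 1"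
        using \<open>C \<noteq> 0\<close> by (simp add: t_def abs_mult)
      ultimately show False by simp
    qed
    with t show ?thesis by (auto simp: not_le)
  qed
  ultimately show ?thesis
    unfolding subregular_error_def using mix_inf_nonneg by blast
qed

section \<open>The mixed quadrangle, its monotonicity and its homogeneity\<close>

lemma quadrangle_mix:
  "subregular_quadrangle M p (mix_sum r w R) (mix_sum r w D) (mix_inf r w V) (mix_inf r w E)
     (mix_statistic r w S)"
proof -
  \<comment> \<open>The constant \<open>C\<close> cancels against the expectation of
    \<open>X - C\<close>, so the two objectives differ by a term independent of
    \<open>C\<close>.\<close>
  have regret_shift: "ereal C + mix_inf r w V (\<lambda>\<omega>. X \<omega> - C) =
      mix_inf r w E (\<lambda>\<omega>. X \<omega> - C) + ereal (expectation X)" if X: "X \<in> Lp M p" for X C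
    using mix_inf_V[OF Lp_diff_const[OF X]]
    by (cases "mix_inf r w E (\<lambda>\<omega>. X \<omega> - C)") (simp_all add: expectation_diff_const[OF X])
  have S: "mix_statistic r w S X = argmin_set (\<lambda>C. mix_inf r w E (\<lambda>\<omega>. X \<omega> - C))"
    if X: "X \<in> Lp M p" for X
    unfolding argmin_set_eq[OF mix_sum_min[OF X]] using mix_inf_eq_mix_sum_iff[OF X] by blast
  show ?thesis
    unfolding subregular_quadrangle_def
  proof (intro conjI ballI)
    show "subregular_risk M p (mix_sum r w R)"
      using deviation_mix_sum mix_sum_R by (rule subregular_risk_of_deviation)
    show "subregular_regret M p (mix_inf r w V)"
      using error_mix_inf mix_inf_V by (rule subregular_regret_of_error)
    fix X assume X: "X \<in> Lp M p"
    show "is_min_of (mix_sum r w R X) (\<lambda>C. ereal C + mix_inf r w V (\<lambda>\<omega>. X \<omega> - C)) (\<lambda>_. True)"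
      by (rule is_min_of_add[OF mix_sum_min[OF X] regret_shift[OF X] mix_sum_R[OF X]])
    show "mix_statistic r w S X = argmin_set (\<lambda>C. ereal C + mix_inf r w V (\<lambda>\<omega>. X \<omega> - C))"
      unfolding S[OF X] by (rule argmin_set_add[OF regret_shift[OF X], symmetric])
  qed (rule deviation_mix_sum error_mix_inf mix_sum_min mix_sum_R mix_inf_V S; assumption?)+
qed

text \<open>Subtracting the same tuple from \<open>X\<close> and \<open>Y\<close> preserves the
  order, so \<open>shifted_sum\<close> is monotone for each fixed tuple and the infimum inherits
  this.\<close>

lemma monotone_mix:
  assumes mono: "\<forall>k\<in>{1..r}. monotone_quadrangle M p (R k) (D k) (V k) (E k)"
  shows "monotone_quadrangle M p (mix_sum r w R) (mix_sum r w D) (mix_inf r w V) (mix_inf r w E)"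
  unfolding monotone_quadrangle_def monotone_functional_def
proof (intro conjI ballI impI)
  fix X Y assume XY: "X \<in> Lp M p" "Y \<in> Lp M p" "AE \<omega> in M. X \<omega> \<le> Y \<omega>"
  have "R k X \<le> R k Y" if "k \<in> {1..r}" for k
    using mono that XY by (intro monotone_functionalD) (auto simp: monotone_quadrangle_def)
  then show "mix_sum r w R X \<le> mix_sum r w R Y"
    unfolding mix_sum_def
    by (intro sum_mono ereal_mult_left_mono) (auto simp: w_pos less_imp_le)
  have "V k (\<lambda>\<omega>. X \<omega> - c) \<le> V k (\<lambda>\<omega>. Y \<omega> - c)" if "k \<in> {1..r}" for k c
  proof -
    have "AE \<omega> in M. X \<omega> - c \<le> Y \<omega> - c" using XY(3) by eventually_elim simp
    then show ?thesis
      using mono that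
      by (intro monotone_functionalD[OF _ Lp_diff_const[OF XY(1)] Lp_diff_const[OF XY(2)]])
        (auto simp: monotone_quadrangle_def)
  qed
  then have "shifted_sum r w V X c \<le> shifted_sum r w V Y c" for c
    unfolding shifted_sum_def
    by (intro sum_mono ereal_mult_left_mono) (auto simp: w_pos less_imp_le)
  then show "mix_inf r w V X \<le> mix_inf r w V Y"
    unfolding mix_inf_def by (intro INF_mono) blast
qed

lemma pos_homogeneous_mix:
  assumes hom: "\<forall>k\<in>{1..r}. pos_homogeneous_quadrangle M p (R k) (D k) (V k) (E k)"
  shows "pos_homogeneous_quadrangle M p (mix_sum r w R) (mix_sum r w D) (mix_inf r w V) (mix_inf r w E)"
proof -
  have D: "D k (\<lambda>\<omega>. t * X \<omega>) = ereal t * D k X" and E: "E k (\<lambda>\<omega>. t * X \<omega>) = ereal t * E k X"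
    if "k \<in> {1..r}" "X \<in> Lp M p" "0 < t" for k X t
    using hom that unfolding pos_homogeneous_quadrangle_def pos_homogeneous_def by blast+
  have mix_D: "pos_homogeneous M p (mix_sum r w D)"
    unfolding pos_homogeneous_def mix_sum_def
  proof (intro ballI allI impI)
    fix X and t :: real assume X: "X \<in> Lp M p" and t: "0 < t"
    have "(\<Sum>k=1..r. ereal (w k) * D k (\<lambda>\<omega>. t * X \<omega>)) = (\<Sum>k=1..r. ereal t * (ereal (w k) * D k X))"
      using X t by (intro sum.cong) (auto simp: D mult.left_commute)
    also have "\<dots> = ereal t * (\<Sum>k=1..r. ereal (w k) * D k X)"
      using X by (intro sum_ereal_right_distrib[symmetric] ereal_0_le_mult) (auto simp: w_pos less_imp_le D_nonneg)
    finally show "(\<Sum>k=1..r. ereal (w k) * D k (\<lambda>\<omega>. t * X \<omega>)) = \<dots>" .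
  qed
  have mix_E: "pos_homogeneous M p (mix_inf r w E)"
  proof (rule pos_homogeneousI)
    fix X and t :: real assume X: "X \<in> Lp M p" and t: "0 < t"
    obtain c where c: "balanced r w c" "mix_inf r w E X = shifted_sum r w E X c"
      using mix_inf_attained[OF X] .
    \<comment> \<open>Scaling an optimal tuple by \<open>t\<close> keeps it balanced and gives a
      competitor for \<open>t * X\<close>, which is all that \<open>pos_homogeneousI\<close> asks
      for.\<close>
    have tc: "balanced r w (\<lambda>k. t * c k)"
      using c(1) by (simp add: balanced_def mult.left_commute flip: sum_distrib_left)
    have "E k (\<lambda>\<omega>. t * X \<omega> - t * c k) = ereal t * E k (\<lambda>\<omega>. X \<omega> - c k)" if "k \<in> {1..r}" for k
      using E[OF that Lp_diff_const[OF X] t, of "c k"] by (simp add: right_diff_distrib)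
    then have "shifted_sum r w E (\<lambda>\<omega>. t * X \<omega>) (\<lambda>k. t * c k) =
        (\<Sum>k=1..r. ereal t * (ereal (w k) * E k (\<lambda>\<omega>. X \<omega> - c k)))"
      unfolding shifted_sum_def by (intro sum.cong) (auto simp: mult.left_commute)
    also have "\<dots> = ereal t * shifted_sum r w E X c"
      unfolding shifted_sum_def using X
      by (intro sum_ereal_right_distrib[symmetric] ereal_0_le_mult)
        (auto simp: w_pos less_imp_le E_nonneg Lp_diff_const)
    finally have "shifted_sum r w E (\<lambda>\<omega>. t * X \<omega>) (\<lambda>k. t * c k) = ereal t * shifted_sum r w E X c" .
    with mix_inf_le[OF tc, of E "\<lambda>\<omega>. t * X \<omega>"] c(2)
    show "mix_inf r w E (\<lambda>\<omega>. t * X \<omega>) \<le> ereal t * mix_inf r w E X" by simp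
  qed
  have "pos_homogeneous M p (mix_sum r w R)"
    using mix_D mix_sum_nonneg mix_sum_R by (rule pos_homogeneous_add_expectation)
  moreover have "pos_homogeneous M p (mix_inf r w V)"
    using mix_E mix_inf_nonneg mix_inf_V by (rule pos_homogeneous_add_expectation)
  ultimately show ?thesis
    unfolding pos_homogeneous_quadrangle_def using mix_D mix_E by blast
qed

end

text \<open>Since \<open>mix_inf\<close> is an infimum by definition, the first conjunct records
  that it is attained at a balanced tuple, as the minima in the formulas for regret and error
  assert.\<close>

theorem theorem16:
  fixes M :: "'a measure" and p :: ennreal and r :: nat
    and w :: "nat \<Rightarrow> real"
    and R D V E :: "nat \<Rightarrow> ('a \<Rightarrow> real) \<Rightarrow> ereal"
    and S :: "nat \<Rightarrow> ('a \<Rightarrow> real) \<Rightarrow> real set"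
  assumes "prob_space M" and "1 \<le> p"
    and "\<forall>k\<in>{1..r}. subregular_quadrangle M p (R k) (D k) (V k) (E k) (S k)"
    and "\<forall>k\<in>{1..r}. 0 < w k" and "(\<Sum>k=1..r. w k) = 1"
  shows "(\<forall>X\<in>Lp M p.
            is_min_of (mix_inf r w V X) (shifted_sum r w V X) (balanced r w) \<and>
            is_min_of (mix_inf r w E X) (shifted_sum r w E X) (balanced r w)) \<and>
         subregular_quadrangle M p (mix_sum r w R) (mix_sum r w D) (mix_inf r w V) (mix_inf r w E)
           (mix_statistic r w S) \<and>
         ((\<forall>k\<in>{1..r}. monotone_quadrangle M p (R k) (D k) (V k) (E k)) \<longrightarrow>
            monotone_quadrangle M p (mix_sum r w R) (mix_sum r w D) (mix_inf r w V) (mix_inf r w E)) \<and>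
         ((\<forall>k\<in>{1..r}. pos_homogeneous_quadrangle M p (R k) (D k) (V k) (E k)) \<longrightarrow>
            pos_homogeneous_quadrangle M p (mix_sum r w R) (mix_sum r w D) (mix_inf r w V) (mix_inf r w E))"
proof -
  interpret risk_quadrangles M p r w R D V E S
    using assms by (intro risk_quadrangles.intro prob_Lp.intro prob_Lp_axioms.intro
        risk_quadrangles_axioms.intro) auto
  show ?thesis
    using mix_inf_V_min mix_inf_E_min quadrangle_mix monotone_mix pos_homogeneous_mix by blast
qed

end
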